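(* Let $n_L$ be fixed and consider a sequence of hub models with a null component with $n\to\infty$, $T\to\infty$, satisfying the standing assumption on $\rho$ in the context. Let $d,v\in(0,1]$ (possibly depending on the index of the sequence) be such that: (i) for each $i=1,\dots,n_L$ there exists a set $V_i\subset\{1,\dots,n\}$ with $|V_i|\ge vn/n_L$ and $A_{ij}-A_{i'j}\ge d$ for all $j\in V_i$ and all $i'\in\{0,1,\dots,n_L\}$, $i'\ne i$; (ii) $A_{ii'}$ is bounded away from $1$ (by a constant) for all $i\in\{0,\dots,n_L\}$, $i'\in\{1,\dots,n_L\}$, $i\ne i'$. If $(\log T)/(d^2vT)=o(1)$, $d^4v^2n\to\infty$ and $(\log n)/T=o(1)$, then $$\max_{i\in\{0,\dots,n_L\},\,j\in\{1,\dots,n\}}\left|\hat A^{\hat z}_{ij}-A_{ij}\right|=o_p(1).$$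
   Context: Hub model with a null component: nodes $1,\dots,n$; leaders (possible hubs) $1,\dots,n_L$ with $n_L\le n$; label $0$ denotes a hubless group. Parameters: $\rho=(\rho_0,\dots,\rho_{n_L})$ with $\rho_i\ge0$, $\sum_{i=0}^{n_L}\rho_i=1$, and $A=(A_{ij})_{0\le i\le n_L,1\le j\le n}$ with entries in $[0,1]$ and $A_{ii}=1$ for $1\le i\le n_L$ (row $0$ is also denoted $\pi_j=A_{0j}$). Independently for $t=1,\dots,T$, a latent label $z_*^{(t)}\in\{0,\dots,n_L\}$ is drawn with $\mathbb P(z_*^{(t)}=i)=\rho_i$, and given $z_*^{(t)}=i$ the variables $G_j^{(t)}\in\{0,1\}$, $j=1,\dots,n$, are independent with $\mathbb P(G_j^{(t)}=1\mid z_*^{(t)}=i)=A_{ij}$. Only $G$ is observed. Profile likelihood estimator: for an assignment $z=(z^{(1)},\dots,z^{(T)})\in\{0,\dots,n_L\}^T$ let $t_i=\sum_t1(z^{(t)}=i)$, $\hat A^z_{ij}=\frac1{t_i}\sum_tG_j^{(t)}1(z^{(t)}=i)$ (set to $0$, say, if $t_i=0$), and $$L_G(z)=\sum_{t=1}^T\sum_{j=1}^n G_j^{(t)}\log\hat A^z_{z^{(t)},j}+(1-G_j^{(t)})\log(1-\hat A^z_{z^{(t)},j}),\qquad 0\log0=0.$$ An assignment is feasible if, for every $t$, either $z^{(t)}=0$ or $G^{(t)}_{z^{(t)}}=1$. $\hat z$ is a maximizer of $L_G(z)$ over feasible assignments, and $\hat A^{\hat z}$ is $\hat A^z$ at $z=\hat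 z$. Asymptotics: $n,T,\rho,A,d,v$ vary along a sequence while $n_L$ is fixed; $o(1)$ and $o_p(1)$ are along this sequence, and "constant" means independent of the sequence index. Standing assumption: $\min_{0\le i\le n_L}\rho_i=c_{\min*}/n_L$ and $\max_{0\le i\le n_L}\rho_i=c_{\max*}/n_L$ with positive constants $c_{\min*},c_{\max*}$. *)

theory Defs
  imports "HOL-Probability.Probability"
begin

section \<open>The hub model with a null component\<close>

text \<open>
  Nodes are \<open>1,\<dots>,n\<close>, leaders are \<open>1,\<dots>,nL\<close>, and the label \<open>0\<close> stands for a hubless group.
  Row \<open>0\<close> of \<open>A\<close> is the vector called \<open>\<pi>\<close> in the literature. Values of \<open>\<rho>\<close> and \<open>A\<close> outside
  the index ranges are irrelevant.
\<close>

definition hub_model :: "nat \<Rightarrow> nat \<Rightarrow> (nat \<Rightarrow> real) \<Rightarrow> (nat \<Rightarrow> nat \<Rightarrow> real) \<Rightarrow> bool" where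
  "hub_model nL n \<rho> A \<longleftrightarrow>
     1 \<le> nL \<and> nL \<le> n \<and>
     (\<forall>i\<in>{0..nL}. 0 \<le> \<rho> i) \<and> (\<Sum>i=0..nL. \<rho> i) = 1 \<and>
     (\<forall>i\<in>{0..nL}. \<forall>j\<in>{1..n}. 0 \<le> A i j \<and> A i j \<le> 1) \<and>
     (\<forall>i\<in>{1..nL}. A i i = 1)"

definition label_pmf :: "nat \<Rightarrow> (nat \<Rightarrow> real) \<Rightarrow> nat pmf" where
  "label_pmf nL \<rho> = embed_pmf (\<lambda>i. if i \<in> {0..nL} then \<rho> i else 0)"

lemma pmf_label_pmf:
  assumes "hub_model nL n \<rho> A"
  shows "pmf (label_pmf nL \<rho>) i = (if i \<in> {0..nL} then \<rho> i else 0)"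
proof -
  let ?f = "\<lambda>i. if i \<in> {0..nL} then \<rho> i else 0"
  have nn: "\<And>i. 0 \<le> ?f i" using assms by (auto simp: hub_model_def)
  have "(\<integral>\<^sup>+i. ennreal (?f i) \<partial>count_space UNIV) = (\<Sum>i\<in>{0..nL}. ennreal (?f i))"
    by (rule nn_integral_count_space') auto
  also have "\<dots> = ennreal (\<Sum>i=0..nL. ?f i)"
    using nn by (intro sum_ennreal)
  also have "(\<Sum>i=0..nL. ?f i) = 1"
    using assms by (simp add: hub_model_def)
  finally have "(\<integral>\<^sup>+i. ennreal (?f i) \<partial>count_space UNIV) = 1" by simp
  then show ?thesis unfolding label_pmf_def using nn by (intro pmf_embed_pmf) auto
qed

text \<open>
  The joint law of one pair \<open>(z\<^sub>*, (G\<^sub>j)\<^sub>j)\<close>, and of \<open>T\<close> independent copies of it indexed by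
  \<open>1,\<dots>,T\<close>. Coordinates outside the index ranges take a fixed dummy value.
\<close>

definition group_pmf ::
  "nat \<Rightarrow> nat \<Rightarrow> (nat \<Rightarrow> real) \<Rightarrow> (nat \<Rightarrow> nat \<Rightarrow> real) \<Rightarrow> (nat \<times> (nat \<Rightarrow> bool)) pmf" where
  "group_pmf nL n \<rho> A =
     do { i \<leftarrow> label_pmf nL \<rho>;
          g \<leftarrow> Pi_pmf {1..n} False (\<lambda>j. bernoulli_pmf (A i j));
          return_pmf (i, g) }"

definition sample_pmf ::
  "nat \<Rightarrow> nat \<Rightarrow> nat \<Rightarrow> (nat \<Rightarrow> real) \<Rightarrow> (nat \<Rightarrow> nat \<Rightarrow> real)
    \<Rightarrow> (nat \<Rightarrow> nat \<times> (nat \<Rightarrow> bool)) pmf" where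
  "sample_pmf nL n T \<rho> A = Pi_pmf {1..T} (0, \<lambda>_. False) (\<lambda>_. group_pmf nL n \<rho> A)"

definition observed :: "(nat \<Rightarrow> nat \<times> (nat \<Rightarrow> bool)) \<Rightarrow> nat \<Rightarrow> nat \<Rightarrow> bool" where
  "observed \<omega> t j = snd (\<omega> t) j"


section \<open>The profile likelihood estimator\<close>

definition label_count :: "nat \<Rightarrow> (nat \<Rightarrow> nat) \<Rightarrow> nat \<Rightarrow> nat" where
  "label_count T z i = card {t \<in> {1..T}. z t = i}"

text \<open>If no group carries the label \<open>i\<close>, this is \<open>0\<close> because \<open>x / 0 = 0\<close>.\<close>

definition A_hat :: "nat \<Rightarrow> (nat \<Rightarrow> nat \<Rightarrow> bool) \<Rightarrow> (nat \<Rightarrow> nat) \<Rightarrow> nat \<Rightarrow> nat \<Rightarrow> real" where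
  "A_hat T G z i j =
     (\<Sum>t=1..T. of_bool (G t j) * of_bool (z t = i)) / real (label_count T z i)"

text \<open>
  The convention \<open>0 log 0 = 0\<close> holds since \<open>ln 0 = 0\<close> in HOL. No term \<open>1 log 0\<close> ever occurs:
  \<open>G t j\<close> forces \<open>A_hat T G z (z t) j > 0\<close>, and \<open>\<not> G t j\<close> forces \<open>A_hat T G z (z t) j < 1\<close>.
\<close>

definition profile_loglik ::
  "nat \<Rightarrow> nat \<Rightarrow> (nat \<Rightarrow> nat \<Rightarrow> bool) \<Rightarrow> (nat \<Rightarrow> nat) \<Rightarrow> real" where
  "profile_loglik n T G z =
     (\<Sum>t=1..T. \<Sum>j=1..n.
        of_bool (G t j) * ln (A_hat T G z (z t) j) +
        (1 - of_bool (G t j)) * ln (1 - A_hat T G z (z t) j))"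

definition feasible ::
  "nat \<Rightarrow> nat \<Rightarrow> (nat \<Rightarrow> nat \<Rightarrow> bool) \<Rightarrow> (nat \<Rightarrow> nat) \<Rightarrow> bool" where
  "feasible nL T G z \<longleftrightarrow> (\<forall>t\<in>{1..T}. z t \<in> {0..nL} \<and> (z t = 0 \<or> G t (z t)))"

text \<open>
  An estimator selects, for every data array, one of the (possibly many) feasible maximizers.
\<close>

definition profile_likelihood_estimator ::
  "nat \<Rightarrow> nat \<Rightarrow> nat \<Rightarrow> ((nat \<Rightarrow> nat \<Rightarrow> bool) \<Rightarrow> (nat \<Rightarrow> nat)) \<Rightarrow> bool" where
  "profile_likelihood_estimator nL n T zhat \<longleftrightarrow>
     (\<forall>G. is_arg_max (profile_loglik n T G) (feasible nL T G) (zhat G))"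

definition A_hat_error ::
  "nat \<Rightarrow> nat \<Rightarrow> nat \<Rightarrow> (nat \<Rightarrow> nat \<Rightarrow> real) \<Rightarrow> (nat \<Rightarrow> nat \<Rightarrow> bool) \<Rightarrow> (nat \<Rightarrow> nat) \<Rightarrow> real" where
  "A_hat_error nL n T A G z =
     Max ((\<lambda>(i, j). \<bar>A_hat T G z i j - A i j\<bar>) ` ({0..nL} \<times> {1..n}))"


section \<open>Convergence to zero in probability along a sequence of models\<close>

definition is_op1 :: "(nat \<Rightarrow> 'a pmf) \<Rightarrow> (nat \<Rightarrow> 'a \<Rightarrow> real) \<Rightarrow> bool" where
  "is_op1 P X \<longleftrightarrow>
     (\<forall>\<epsilon>>0. (\<lambda>m. measure_pmf.prob (P m) {\<omega>. \<bar>X m \<omega>\<bar> > \<epsilon>}) \<longlonglongrightarrow> 0)"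

end

theory Submission
  imports Defs
begin

text \<open>
  Let \<open>z\<^sub>*\<close> be the true labelling. It is feasible, and plugging in the true \<open>A\<close> only lowers the
  profile likelihood, so the estimate \<open>z\<close> together with \<open>B = A_hat z\<close> has likelihood at least that
  of \<open>(z\<^sub>*, A)\<close>. For a fixed pair \<open>(z, B)\<close> the expected square root of this likelihood ratio is a
  product of Bhattacharyya coefficients, whence (Chernoff) such a pair beats the truth with
  probability at most \<open>exp (- Q / 4)\<close>, where \<open>Q\<close> is the sum of the squares
  \<open>(B (z t) j - A (z\<^sub>* t) j)\<^sup>2\<close>. There are \<open>(nL + 1) ^ T\<close> labellings, and the entries of \<open>B\<close> are
  fractions with denominator at most \<open>T\<close>; since \<open>d\<^sup>2 v n \<rightarrow> \<infinity>\<close> and \<open>log T = o(d\<^sup>2 v T)\<close>, a union bound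
  gives \<open>Q = o(d\<^sup>2 v n T)\<close> for the estimate.

  Rows of \<open>A\<close> are at squared distance at least \<open>d\<^sup>2 v n / nL\<close>, so no estimated class can contain a
  positive fraction of two true classes. Hence estimated and true classes match up to a
  permutation. Feasibility makes the permutation trivial: only a fraction bounded away from one of
  the groups of class \<open>k\<close> can be given a label \<open>i \<noteq> k\<close> with \<open>i \<ge> 1\<close>. So all but \<open>o(T)\<close> labels
  are correct, and Hoeffding's inequality for the true classes finishes the proof.
\<close>

section \<open>The likelihood and its maximizer for given labels\<close>

definition bern_lik :: "real \<Rightarrow> bool \<Rightarrow> real" where
  "bern_lik p g = (if g then p else 1 - p)"

definition lik :: "nat \<Rightarrow> nat \<Rightarrow> (nat \<Rightarrow> nat \<Rightarrow> bool) \<Rightarrow> (nat \<Rightarrow> nat) \<Rightarrow> (nat \<Rightarrow> nat \<Rightarrow> real) \<Rightarrow> real" where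
  "lik n T G z B = (\<Prod>t=1..T. \<Prod>j=1..n. bern_lik (B (z t) j) (G t j))"

lemma bern_lik_nonneg: "0 \<le> p \<Longrightarrow> p \<le> 1 \<Longrightarrow> 0 \<le> bern_lik p g"
  by (simp add: bern_lik_def)

text \<open>The inequality of arithmetic and geometric means for mean at most \<open>1\<close>:
  bounding each factor by \<open>exp (x t - 1)\<close> turns the product into an exponential with
  nonpositive exponent.\<close>

lemma prod_le_one_of_sum_le_card:
  fixes x :: "'a \<Rightarrow> real"
  assumes "finite S" "\<And>t. t \<in> S \<Longrightarrow> 0 \<le> x t" "sum x S \<le> real (card S)"
  shows "prod x S \<le> 1"
proof -
  have "prod x S \<le> (\<Prod>t\<in>S. exp (x t - 1))"
    using assms(2) exp_ge_add_one_self[of "x _ - 1"] by (intro prod_mono) auto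
  also have "\<dots> = exp (sum x S - real (card S))"
    using assms(1) by (simp add: exp_sum[symmetric] sum_subtractf)
  also have "\<dots> \<le> 1" using assms(3) by simp
  finally show ?thesis .
qed

lemma mean_of_bool_pos:
  assumes "finite S" "t \<in> S" "g t"
  shows "0 < (\<Sum>s\<in>S. of_bool (g s)) / real (card S)"
proof -
  have "(1::real) = of_bool (g t)" using assms by simp
  also have "\<dots> \<le> (\<Sum>s\<in>S. of_bool (g s))" using assms by (intro member_le_sum) auto
  finally have "0 < (\<Sum>s\<in>S. of_bool (g s) :: real)" by linarith
  moreover have "0 < card S" using assms card_gt_0_iff by blast
  ultimately show ?thesis by simp
qed

lemma one_minus_mean_of_bool:
  assumes "finite S" "S \<noteq> {}"
  shows "1 - (\<Sum>s\<in>S. of_bool (g s)) / real (card S)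
       = (\<Sum>s\<in>S. of_bool (\<not> g s)) / real (card S)"
proof -
  have "(\<Sum>s\<in>S. of_bool (\<not> g s)) = real (card S) - (\<Sum>s\<in>S. of_bool (g s))"
    using assms by (simp add: of_bool_not_iff sum_subtractf)
  then show ?thesis using assms by (simp add: field_simps card_gt_0_iff)
qed

text \<open>The observation \<open>g t\<close> itself contributes to the mean, so the empirical
  frequency never gives probability \<open>0\<close> to an observed value. This justifies the later
  divisions and logarithms.\<close>

lemma bern_lik_mean_pos:
  assumes "finite S" "t \<in> S"
  shows "0 < bern_lik ((\<Sum>s\<in>S. of_bool (g s)) / real (card S)) (g t)"
proof (cases "g t")
  case True
  then show ?thesis using mean_of_bool_pos[OF assms, of g] by (simp only: bern_lik_def if_True)
next
  case False
  have "S \<noteq> {}" using assms by auto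
  with False show ?thesis
    using mean_of_bool_pos[OF assms, of "\<lambda>s. \<not> g s"] one_minus_mean_of_bool[OF assms(1)]
    by (simp only: bern_lik_def if_False not_False_eq_True)
qed

text \<open>The likelihood ratios of \<open>p\<close> against \<open>q\<close>, averaged over
  \<open>S\<close>, give \<open>q * (p / q) + (1 - q) * ((1 - p) / (1 - q))\<close>, which is at
  most \<open>1\<close>; hence so is their product. Avoiding logarithms lets \<open>p\<close> be
  \<open>0\<close> or \<open>1\<close>.\<close>

lemma bernoulli_mle:
  fixes p :: real and g :: "'a \<Rightarrow> bool"
  assumes "finite S" "0 \<le> p" "p \<le> 1"
  defines "q \<equiv> (\<Sum>s\<in>S. of_bool (g s)) / real (card S)"
  shows "(\<Prod>t\<in>S. bern_lik p (g t)) \<le> (\<Prod>t\<in>S. bern_lik q (g t))"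
proof (cases "S = {}")
  case False
  let ?b = "real (card S)"
  have b: "0 < ?b" using False assms(1) by (simp add: card_gt_0_iff)
  have pos: "0 < bern_lik q (g t)" if "t \<in> S" for t
    unfolding q_def using bern_lik_mean_pos[OF assms(1) that] .
  have q1: "(\<Sum>t\<in>S. of_bool (g t)) = ?b * q" using b by (simp add: q_def)
  have q2: "(\<Sum>t\<in>S. of_bool (\<not> g t)) = ?b * (1 - q)"
    using b one_minus_mean_of_bool[OF assms(1) False, of g] by (simp add: q_def field_simps)
  have q: "0 \<le> q" "0 \<le> 1 - q"
    using q1 q2 b sum_nonneg[of S "\<lambda>t. of_bool (g t) :: real"]
      sum_nonneg[of S "\<lambda>t. of_bool (\<not> g t) :: real"]
    by (auto simp: zero_le_mult_iff)
  have "(\<Sum>t\<in>S. bern_lik p (g t) / bern_lik q (g t))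
      = (\<Sum>t\<in>S. of_bool (g t) * (p / q) + of_bool (\<not> g t) * ((1 - p) / (1 - q)))"
    by (intro sum.cong) (auto simp: bern_lik_def)
  also have "\<dots> = ?b * (q * (p / q)) + ?b * ((1 - q) * ((1 - p) / (1 - q)))"
    by (simp only: sum.distrib sum_distrib_right[symmetric] q1 q2 mult.assoc)
  \<comment> \<open>Only an inequality: for \<open>q = 0\<close> or \<open>q = 1\<close> one
    quotient has denominator \<open>0\<close> and counts as \<open>0\<close>.\<close>
  also have "\<dots> \<le> ?b * p + ?b * (1 - p)"
    using assms q b by (intro add_mono mult_left_mono) (auto)
  finally have "(\<Sum>t\<in>S. bern_lik p (g t) / bern_lik q (g t)) \<le> ?b" by (simp add: algebra_simps)
  then have "(\<Prod>t\<in>S. bern_lik p (g t) / bern_lik q (g t)) \<le> 1"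
    using assms pos by (intro prod_le_one_of_sum_le_card)
      (auto intro!: divide_nonneg_pos bern_lik_nonneg)
  then show ?thesis
    using prod_pos[of S "\<lambda>t. bern_lik q (g t)"] pos by (simp add: prod_dividef)
qed simp

lemma A_hat_eq_mean:
  "A_hat T G z i j = (\<Sum>t\<in>{t\<in>{1..T}. z t = i}. of_bool (G t j)) / real (card {t\<in>{1..T}. z t = i})"
proof -
  have "(\<Sum>t=1..T. of_bool (G t j) * of_bool (z t = i) :: real)
      = (\<Sum>t=1..T. if z t = i then of_bool (G t j) else 0)"
    by (intro sum.cong) auto
  then show ?thesis
    by (simp only: A_hat_def label_count_def sum.inter_filter finite_atLeastAtMost)
qed

lemma bern_lik_A_hat_pos:
  assumes "t \<in> {1..T}"
  shows "0 < bern_lik (A_hat T G z (z t) j) (G t j)"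
  unfolding A_hat_eq_mean using assms by (intro bern_lik_mean_pos) auto

text \<open>No logarithm is ever taken at \<open>0\<close> with nonzero weight, so nothing is lost
  in passing from sums of logarithms to products.\<close>

lemma exp_profile_loglik: "exp (profile_loglik n T G z) = lik n T G z (A_hat T G z)"
proof -
  have "profile_loglik n T G z
      = (\<Sum>t=1..T. \<Sum>j=1..n. ln (bern_lik (A_hat T G z (z t) j) (G t j)))"
    unfolding profile_loglik_def by (intro sum.cong refl) (simp add: bern_lik_def)
  then show ?thesis
    unfolding lik_def by (simp add: exp_sum bern_lik_A_hat_pos cong: prod.cong_simp)
qed

text \<open>For fixed \<open>j\<close>, the groups sharing a label form a Bernoulli sample with one
  parameter, so \<open>bernoulli_mle\<close> applies to each label class separately.\<close>

lemma lik_le_profile: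
  assumes "\<And>t j. t \<in> {1..T} \<Longrightarrow> j \<in> {1..n} \<Longrightarrow> 0 \<le> B (z t) j \<and> B (z t) j \<le> 1"
  shows "lik n T G z B \<le> lik n T G z (A_hat T G z)"
proof -
  have group: "(\<Prod>t=1..T. bern_lik (C (z t) j) (G t j))
      = (\<Prod>i\<in>z ` {1..T}. \<Prod>t\<in>{t\<in>{1..T}. z t = i}. bern_lik (C i j) (G t j))" for C j
    by (subst prod.group[of "{1..T}" "z ` {1..T}" z, symmetric]) auto
  have "(\<Prod>i\<in>z ` {1..T}. \<Prod>t\<in>{t\<in>{1..T}. z t = i}. bern_lik (B i j) (G t j))
      \<le> (\<Prod>i\<in>z ` {1..T}. \<Prod>t\<in>{t\<in>{1..T}. z t = i}. bern_lik (A_hat T G z i j) (G t j))"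
    if "j \<in> {1..n}" for j
    unfolding A_hat_eq_mean
    using assms that by (intro prod_mono conjI bernoulli_mle prod_nonneg bern_lik_nonneg) auto
  then have "(\<Prod>t=1..T. bern_lik (B (z t) j) (G t j))
      \<le> (\<Prod>t=1..T. bern_lik (A_hat T G z (z t) j) (G t j))" if "j \<in> {1..n}" for j
    unfolding group[of B j] group[of "A_hat T G z" j] using that .
  then have "(\<Prod>j=1..n. \<Prod>t=1..T. bern_lik (B (z t) j) (G t j))
      \<le> (\<Prod>j=1..n. \<Prod>t=1..T. bern_lik (A_hat T G z (z t) j) (G t j))"
    using assms by (intro prod_mono[where A = "{1..n}"]) (auto intro!: prod_nonneg bern_lik_nonneg)
  then show ?thesis
    unfolding lik_def by (subst (1 2) prod.swap)
qed

section \<open>The confusion matrix\<close>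

text \<open>By pigeonhole every column \<open>k\<close> has an entry above \<open>M\<close>, in row
  \<open>s k\<close> say, and by \<open>small\<close> no row has two such entries. So
  \<open>s\<close> is a permutation, all entries off its graph are at most \<open>M\<close>, and the
  entry on the graph nearly exhausts the column. The condition \<open>hub\<close> forbids this in a
  row \<open>i \<ge> 1\<close> with \<open>i \<noteq> k\<close>.\<close>

lemma confusion_matrix_diagonal:
  fixes C :: "nat \<Rightarrow> nat \<Rightarrow> real" and M :: real
  assumes total: "\<And>k. k \<le> nL \<Longrightarrow> (\<Sum>i\<le>nL. C i k) = N k"
    and small: "\<And>i k k'. i \<le> nL \<Longrightarrow> k \<le> nL \<Longrightarrow> k' \<le> nL \<Longrightarrow> k \<noteq> k' \<Longrightarrow> C i k \<le> M \<or> C i k' \<le> M"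
    and big: "\<And>k. k \<le> nL \<Longrightarrow> (real nL + 1) * M < N k"
    and hub: "\<And>i k. 1 \<le> i \<Longrightarrow> i \<le> nL \<Longrightarrow> k \<le> nL \<Longrightarrow> i \<noteq> k \<Longrightarrow> C i k < N k - real nL * M"
    and ik: "i \<le> nL" "k \<le> nL" "i \<noteq> k"
  shows "C i k \<le> M"
proof -
  have "\<exists>i\<le>nL. M < C i k" if "k \<le> nL" for k
  proof (rule ccontr)
    assume "\<not> ?thesis"
    then have "(\<Sum>i\<le>nL. C i k) \<le> (\<Sum>i\<le>nL. M)" by (intro sum_mono) auto
    with total[OF that] big[OF that] show False by (simp add: algebra_simps)
  qed
  then obtain s where s: "\<And>k. k \<le> nL \<Longrightarrow> s k \<le> nL \<and> M < C (s k) k" by metis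
  have inj: "inj_on s {..nL}"
    using s small by (intro inj_onI) (metis atMost_iff not_less)
  then have surj: "s ` {..nL} = {..nL}"
    using s by (intro endo_inj_surj) auto
  have off: "C i k \<le> M" if ik: "i \<le> nL" "k \<le> nL" "i \<noteq> s k" for i k
  proof -
    obtain k' where "k' \<le> nL" "i = s k'" using surj ik(1) by (metis atMost_iff imageE)
    then show ?thesis using s[of k'] small[of i k k'] ik by force
  qed
  have diag: "N k - real nL * M \<le> C (s k) k" if k: "k \<le> nL" for k
  proof -
    have "N k = C (s k) k + (\<Sum>i\<in>{..nL} - {s k}. C i k)"
      using total[OF k] s[OF k] sum.remove[of "{..nL}" "s k" "\<lambda>i. C i k"] by simp
    also have "(\<Sum>i\<in>{..nL} - {s k}. C i k) \<le> (\<Sum>i\<in>{..nL} - {s k}. M)"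
      using off k by (intro sum_mono) auto
    also have "\<dots> = real nL * M" using s[OF k] by simp
    finally show ?thesis by simp
  qed
  have fixed: "s k = k" if "k \<le> nL" "s k \<noteq> 0" for k
    using diag[OF that(1)] hub[of "s k" k] s[OF that(1)] that by force
  \<comment> \<open>So far \<open>s k\<close> is \<open>k\<close> or \<open>0\<close>. In particular
    \<open>s 0 = 0\<close>, and injectivity leaves no other column with value
    \<open>0\<close>.\<close>
  have "s k = k"
    using fixed[of k] fixed[of 0] inj ik(2) by (metis atMost_iff inj_on_eq_iff le0)
  with off ik show ?thesis by metis
qed

text \<open>The parallelogram identity with the square of \<open>(b j - a j) + (b j - c j)\<close>
  dropped.\<close>

lemma squared_distance_split:
  fixes a b c :: "'a \<Rightarrow> real"
  shows "(\<Sum>j\<in>J. (a j - c j)\<^sup>2) \<le> 2 * ((\<Sum>j\<in>J. (b j - a j)\<^sup>2) + (\<Sum>j\<in>J. (b j - c j)\<^sup>2))"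
proof -
  have "(a j - c j)\<^sup>2 \<le> 2 * ((b j - a j)\<^sup>2 + (b j - c j)\<^sup>2)" for j
    using zero_le_power2[of "(b j - a j) + (b j - c j)"] by (simp add: power2_eq_square algebra_simps)
  then have "(\<Sum>j\<in>J. (a j - c j)\<^sup>2) \<le> (\<Sum>j\<in>J. 2 * ((b j - a j)\<^sup>2 + (b j - c j)\<^sup>2))"
    by (intro sum_mono)
  then show ?thesis by (simp add: sum_distrib_left sum.distrib distrib_left)
qed

definition confusion :: "nat \<Rightarrow> (nat \<Rightarrow> nat) \<Rightarrow> (nat \<Rightarrow> nat) \<Rightarrow> nat \<Rightarrow> nat \<Rightarrow> nat" where
  "confusion T zh zs i k = card {t \<in> {1..T}. zh t = i \<and> zs t = k}"

lemma sum_confusion: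
  assumes "\<And>t. t \<in> {1..T} \<Longrightarrow> zh t \<le> nL"
  shows "(\<Sum>i\<le>nL. real (confusion T zh zs i k)) = real (label_count T zs k)"
proof -
  have "(\<Sum>i\<le>nL. card {t \<in> {1..T}. zh t = i \<and> zs t = k}) = card (\<Union>i\<le>nL. {t \<in> {1..T}. zh t = i \<and> zs t = k})"
    by (subst card_UN_disjoint) auto
  also have "(\<Union>i\<le>nL. {t \<in> {1..T}. zh t = i \<and> zs t = k}) = {t \<in> {1..T}. zs t = k}"
    using assms by auto
  finally show ?thesis
    unfolding confusion_def label_count_def by (simp flip: of_nat_sum)
qed

text \<open>One row \<open>B i\<close> cannot be close to two separated rows of \<open>A\<close>: if
  both cells had more than \<open>M\<close> groups, they alone would contribute at least
  \<open>D * M / 2\<close> to the total squared distance.\<close>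

lemma confusion_one_small:
  assumes kk: "k \<noteq> k'"
    and sep: "D \<le> (\<Sum>j=1..n. (A k j - A k' j)\<^sup>2)" and D: "0 < D"
    and close: "(\<Sum>t=1..T. \<Sum>j=1..n. (B (zh t) j - A (zs t) j)\<^sup>2) < D * M / 2"
  shows "real (confusion T zh zs i k) \<le> M \<or> real (confusion T zh zs i k') \<le> M"
proof (rule ccontr)
  let ?S = "\<lambda>k. {t \<in> {1..T}. zh t = i \<and> zs t = k}"
  let ?q = "\<lambda>t. \<Sum>j=1..n. (B (zh t) j - A (zs t) j)\<^sup>2"
  let ?r = "\<lambda>k. \<Sum>j=1..n. (B i j - A k j)\<^sup>2"
  assume "\<not> ?thesis"
  then have big: "M \<le> real (card (?S k))" "M \<le> real (card (?S k'))"
    by (auto simp: confusion_def)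
  have "0 \<le> (\<Sum>t=1..T. ?q t)" by (intro sum_nonneg) auto
  then have "0 < D * M" using close by linarith
  then have M: "0 < M" using D by (simp add: zero_less_mult_iff)
  have r: "0 \<le> ?r k" for k by (intro sum_nonneg) auto
  have class_sum: "(\<Sum>t\<in>?S k. ?q t) = real (card (?S k)) * ?r k" for k
  proof -
    have "(\<Sum>t\<in>?S k. ?q t) = (\<Sum>t\<in>?S k. ?r k)" by (intro sum.cong) auto
    then show ?thesis by simp
  qed
  have "D \<le> 2 * (?r k + ?r k')"
    using sep squared_distance_split[of "\<lambda>j. A k j" "\<lambda>j. A k' j" "{1..n}" "\<lambda>j. B i j"]
    by linarith
  then have "M * D \<le> M * (2 * (?r k + ?r k'))" using M by (intro mult_left_mono) auto
  then have "D * M / 2 \<le> M * (?r k + ?r k')" by (simp add: algebra_simps)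
  also have "\<dots> \<le> real (card (?S k)) * ?r k + real (card (?S k')) * ?r k'"
    using big r by (simp add: distrib_left add_mono mult_right_mono)
  also have "\<dots> = (\<Sum>t\<in>?S k. ?q t) + (\<Sum>t\<in>?S k'. ?q t)"
    by (simp only: class_sum)
  also have "\<dots> = (\<Sum>t\<in>?S k \<union> ?S k'. ?q t)"
    using kk by (subst sum.union_disjoint) auto
  also have "\<dots> \<le> (\<Sum>t=1..T. ?q t)"
    by (intro sum_mono2) (auto intro: sum_nonneg)
  finally show False using close by simp
qed

section \<open>Effect of relabelling a few groups on \<open>A_hat\<close>\<close>

lemma card_Collect_diff_le:
  assumes "finite S"
  shows "\<bar>real (card {t\<in>S. P t}) - real (card {t\<in>S. Q t})\<bar> \<le> real (card {t\<in>S. P t \<noteq> Q t})"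
proof -
  have "card {t\<in>S. P t} \<le> card ({t\<in>S. Q t} \<union> {t\<in>S. P t \<noteq> Q t})"
       "card {t\<in>S. Q t} \<le> card ({t\<in>S. P t} \<union> {t\<in>S. P t \<noteq> Q t})"
    using assms by (auto intro!: card_mono)
  then show ?thesis
    using card_Un_le[of "{t\<in>S. Q t}" "{t\<in>S. P t \<noteq> Q t}"]
      card_Un_le[of "{t\<in>S. P t}" "{t\<in>S. P t \<noteq> Q t}"] by linarith
qed

text \<open>The difference is written over the denominator \<open>b'\<close> alone, using
  \<open>a / b \<le> 1\<close>. Thus only the true class needs a size bound; an empty estimated
  class, \<open>b = 0\<close>, is allowed.\<close>

lemma ratio_perturbation:
  fixes a b a' b' M :: real
  assumes "0 \<le> a" "a \<le> b" "\<bar>a - a'\<bar> \<le> M" "\<bar>b - b'\<bar> \<le> M" "0 < b'"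
  shows "\<bar>a / b - a' / b'\<bar> \<le> 2 * M / b'"
proof -
  have "a / b - a' / b' = (a / b * (b' - b) + (a - a')) / b'"
    using assms by (cases "b = 0") (auto simp: field_simps)
  moreover have "\<bar>a / b * (b' - b) + (a - a')\<bar> \<le> 1 * M + M"
  proof -
    have "\<bar>a / b * (b' - b)\<bar> \<le> 1 * M"
      unfolding abs_mult using assms by (intro mult_mono) (auto simp: divide_le_eq_1)
    then show ?thesis using assms(3) by linarith
  qed
  ultimately show ?thesis
    using assms(5) by (simp add: abs_divide divide_right_mono)
qed

lemma A_hat_count:
  "A_hat T G z i j = real (card {t\<in>{1..T}. z t = i \<and> G t j}) / real (card {t\<in>{1..T}. z t = i})"
proof -
  have "{t\<in>{1..T}. z t = i} \<inter> {t. G t j} = {t\<in>{1..T}. z t = i \<and> G t j}" by auto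
  then show ?thesis by (simp add: A_hat_eq_mean sum_of_bool_eq)
qed

lemma A_hat_perturbation:
  assumes mism: "real (card {t\<in>{1..T}. (zh t = i) \<noteq> (zs t = i)}) \<le> M"
    and pos: "0 < label_count T zs i"
  shows "\<bar>A_hat T G zh i j - A_hat T G zs i j\<bar> \<le> 2 * M / real (label_count T zs i)"
  unfolding A_hat_count label_count_def
proof (rule ratio_perturbation)
  show "0 \<le> real (card {t\<in>{1..T}. zh t = i \<and> G t j})" by simp
  show "real (card {t\<in>{1..T}. zh t = i \<and> G t j}) \<le> real (card {t\<in>{1..T}. zh t = i})"
    by (auto intro!: card_mono)
  have "card {t\<in>{1..T}. (zh t = i \<and> G t j) \<noteq> (zs t = i \<and> G t j)} \<le> card {t\<in>{1..T}. (zh t = i) \<noteq> (zs t = i)}"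
    by (intro card_mono) auto
  with mism finite_atLeastAtMost[of 1 T, THEN card_Collect_diff_le, of "\<lambda>t. zh t = i \<and> G t j" "\<lambda>t. zs t = i \<and> G t j"]
  show "\<bar>real (card {t\<in>{1..T}. zh t = i \<and> G t j}) - real (card {t\<in>{1..T}. zs t = i \<and> G t j})\<bar> \<le> M"
    by linarith
  show "\<bar>real (card {t\<in>{1..T}. zh t = i}) - real (card {t\<in>{1..T}. zs t = i})\<bar> \<le> M"
    using mism finite_atLeastAtMost[of 1 T, THEN card_Collect_diff_le, of "\<lambda>t. zh t = i" "\<lambda>t. zs t = i"] by linarith
  show "0 < real (card {t\<in>{1..T}. zs t = i})" using pos by (simp add: label_count_def)
qed

text \<open>A mismatch at label \<open>i\<close> lies in row \<open>i\<close> or column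
  \<open>i\<close> of the confusion matrix, off the diagonal; these are \<open>2 * nL\<close>
  cells.\<close>

lemma mismatch_card_le:
  assumes lab: "\<And>t. t \<in> {1..T} \<Longrightarrow> zh t \<le> nL \<and> zs t \<le> nL"
    and off: "\<And>i k. i \<le> nL \<Longrightarrow> k \<le> nL \<Longrightarrow> i \<noteq> k \<Longrightarrow> real (confusion T zh zs i k) \<le> M"
    and i: "i \<le> nL"
  shows "real (card {t\<in>{1..T}. (zh t = i) \<noteq> (zs t = i)}) \<le> 2 * real nL * M"
proof -
  let ?K = "{..nL} - {i}"
  let ?S = "\<lambda>i k. {t \<in> {1..T}. zh t = i \<and> zs t = k}"
  have "{t\<in>{1..T}. (zh t = i) \<noteq> (zs t = i)} \<subseteq> (\<Union>k\<in>?K. ?S i k) \<union> (\<Union>k\<in>?K. ?S k i)"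
    using lab by auto
  then have "card {t\<in>{1..T}. (zh t = i) \<noteq> (zs t = i)} \<le> card ((\<Union>k\<in>?K. ?S i k) \<union> (\<Union>k\<in>?K. ?S k i))"
    by (intro card_mono) auto
  also have "\<dots> \<le> (\<Sum>k\<in>?K. card (?S i k)) + (\<Sum>k\<in>?K. card (?S k i))"
    by (intro order.trans[OF card_Un_le] add_mono card_UN_le) auto
  finally have "real (card {t\<in>{1..T}. (zh t = i) \<noteq> (zs t = i)})
      \<le> (\<Sum>k\<in>?K. real (card (?S i k))) + (\<Sum>k\<in>?K. real (card (?S k i)))"
    unfolding of_nat_sum[symmetric] of_nat_add[symmetric] of_nat_le_iff .
  also have "\<dots> \<le> (\<Sum>k\<in>?K. M) + (\<Sum>k\<in>?K. M)"
    using off i by (intro add_mono sum_mono) (auto simp: confusion_def)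
  also have "\<dots> = 2 * real nL * M" using i by simp
  finally show ?thesis .
qed

text \<open>
  Here \<open>D\<close> is the squared distance between rows of \<open>A\<close>, \<open>\<tau>\<close> the tolerated fraction of
  mislabelled groups, \<open>\<eta>\<close> the sampling error and \<open>c\<close> a lower bound for the group proportions.
\<close>

lemma A_hat_deviation:
  fixes D \<tau> \<eta> c ca :: real
  assumes T: "0 < T"
    and zs: "\<And>t. t \<in> {1..T} \<Longrightarrow> zs t \<le> nL"
    and feas: "feasible nL T G zh"
    and sep: "\<And>k k'. k \<le> nL \<Longrightarrow> k' \<le> nL \<Longrightarrow> k \<noteq> k' \<Longrightarrow> D \<le> (\<Sum>j=1..n. (A k j - A k' j)\<^sup>2)"
    and D: "0 < D" and nLn: "nL \<le> n"
    and close: "(\<Sum>t=1..T. \<Sum>j=1..n. (A_hat T G zh (zh t) j - A (zs t) j)\<^sup>2) < D * (\<tau> * T) / 2"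
    and c: "0 < c" and count: "\<And>k. k \<le> nL \<Longrightarrow> c * T \<le> real (label_count T zs k)"
    and freq: "\<And>k j. k \<le> nL \<Longrightarrow> j \<in> {1..n} \<Longrightarrow>
       \<bar>real (card {t\<in>{1..T}. zs t = k \<and> G t j}) - A k j * real (label_count T zs k)\<bar> \<le> \<eta> * T"
    and ca: "\<And>i k. i \<in> {1..nL} \<Longrightarrow> k \<le> nL \<Longrightarrow> i \<noteq> k \<Longrightarrow> A k i \<le> ca" "ca < 1"
    and tau: "(real nL + 1) * \<tau> < c" "\<eta> + real nL * \<tau> < (1 - ca) * c"
    and i: "i \<le> nL" and j: "j \<in> {1..n}"
  shows "\<bar>A_hat T G zh i j - A i j\<bar> \<le> (4 * real nL * \<tau> + \<eta>) / c"
proof -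
  have zh: "\<And>t. t \<in> {1..T} \<Longrightarrow> zh t \<le> nL" and zhG: "\<And>t. t \<in> {1..T} \<Longrightarrow> zh t \<noteq> 0 \<Longrightarrow> G t (zh t)"
    using feas unfolding feasible_def by fastforce+
  have T': "0 < real T" using T by simp
  have off: "real (confusion T zh zs i k) \<le> \<tau> * T" if "i \<le> nL" "k \<le> nL" "i \<noteq> k" for i k
  proof (rule confusion_matrix_diagonal[where nL = nL and M = "\<tau> * T"
        and C = "\<lambda>i k. real (confusion T zh zs i k)" and N = "\<lambda>k. real (label_count T zs k)"])
    show "(\<Sum>i\<le>nL. real (confusion T zh zs i k)) = real (label_count T zs k)" for k
      using zh by (rule sum_confusion)
  next
    fix i k k' assume "k \<le> nL" "k' \<le> nL" "k \<noteq> k'"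
    then show "real (confusion T zh zs i k) \<le> \<tau> * T \<or> real (confusion T zh zs i k') \<le> \<tau> * T"
      using sep D close by (intro confusion_one_small[where D = D and B = "A_hat T G zh" and A = A]) auto
  next
    fix k assume "k \<le> nL"
    have "(real nL + 1) * \<tau> * T < c * T" using tau(1) T' by (rule mult_strict_right_mono)
    with count[OF \<open>k \<le> nL\<close>] show "(real nL + 1) * (\<tau> * T) < real (label_count T zs k)"
      by (simp add: algebra_simps)
  next
    fix i k assume ik: "1 \<le> i" "i \<le> nL" "k \<le> nL" "i \<noteq> k"
    let ?N = "real (label_count T zs k)"
    \<comment> \<open>Feasibility enters here: label \<open>i \<ge> 1\<close> requires node
      \<open>i\<close> to be present, which in class \<open>k\<close> happens with frequency about
      \<open>A k i \<le> ca < 1\<close>.\<close>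
    have "confusion T zh zs i k \<le> card {t\<in>{1..T}. zs t = k \<and> G t i}"
      unfolding confusion_def using zhG ik(1) by (intro card_mono) auto
    moreover have "real (card {t\<in>{1..T}. zs t = k \<and> G t i}) \<le> A k i * ?N + \<eta> * T"
      using freq[of k i] ik nLn by force
    moreover have "A k i * ?N \<le> ca * ?N"
      using ca(1)[of i k] ik by (intro mult_right_mono) auto
    moreover have "(\<eta> + real nL * \<tau>) * T < (1 - ca) * c * T"
      using tau(2) T' by (rule mult_strict_right_mono)
    moreover have "(1 - ca) * (c * T) \<le> (1 - ca) * ?N"
      using count[OF ik(3)] ca(2) by (intro mult_left_mono) auto
    ultimately show "real (confusion T zh zs i k) < ?N - real nL * (\<tau> * T)"
      by (simp add: algebra_simps)
  qed (use that in auto)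
  let ?N = "real (label_count T zs i)"
  have N: "c * T \<le> ?N" "0 < c * T" using count[OF i] c T' by auto
  then have Npos: "0 < ?N" by linarith
  \<comment> \<open>The signs of \<tau> and \<eta> are read off from \<open>close\<close> and
    \<open>freq\<close>, which bound nonnegative quantities.\<close>
  have tau0: "0 \<le> \<tau> * T"
  proof -
    have "0 \<le> (\<Sum>t=1..T. \<Sum>j=1..n. (A_hat T G zh (zh t) j - A (zs t) j)\<^sup>2)"
      by (intro sum_nonneg) auto
    with close have "0 < D * (\<tau> * T)" by linarith
    with D show ?thesis by (auto simp: zero_less_mult_iff)
  qed
  have eta0: "0 \<le> \<eta> * T" using freq[OF i j] by linarith
  have "0 \<le> \<tau>" "0 \<le> \<eta>" using tau0 eta0 T' by (auto simp: zero_le_mult_iff)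
  have "\<bar>A_hat T G zh i j - A_hat T G zs i j\<bar> \<le> 2 * (2 * real nL * (\<tau> * T)) / ?N"
    using Npos by (intro A_hat_perturbation mismatch_card_le off i) (auto simp: zh zs)
  moreover have "\<bar>A_hat T G zs i j - A i j\<bar> \<le> \<eta> * T / ?N"
  proof -
    let ?x = "real (card {t\<in>{1..T}. zs t = i \<and> G t j})"
    have "A_hat T G zs i j = ?x / ?N" by (simp only: A_hat_count label_count_def)
    moreover have "?x / ?N - A i j = (?x - A i j * ?N) / ?N" using Npos by (simp add: field_simps)
    ultimately have "A_hat T G zs i j - A i j = (?x - A i j * ?N) / ?N" by simp
    then show ?thesis using freq[OF i j] Npos by (simp add: abs_divide divide_right_mono)
  qed
  ultimately have "\<bar>A_hat T G zh i j - A i j\<bar> \<le> (2 * (2 * real nL * (\<tau> * T)) + \<eta> * T) / ?N"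
    by (simp add: add_divide_distrib)
  also have "\<dots> \<le> (2 * (2 * real nL * (\<tau> * T)) + \<eta> * T) / (c * T)"
    using N Npos \<open>0 \<le> \<tau>\<close> \<open>0 \<le> \<eta>\<close> by (intro divide_left_mono add_nonneg_nonneg mult_nonneg_nonneg) auto
  also have "\<dots> = (4 * real nL * \<tau> + \<eta>) / c"
    using T' c by (simp add: field_simps)
  finally show ?thesis .
qed

section \<open>Likelihood ratios\<close>

text \<open>Factor \<open>x - y\<close> as a difference of squares of roots; the sum of the roots is
  at most \<open>2\<close>.\<close>

lemma sq_diff_le_sqrt_diff:
  fixes x y :: real
  assumes "0 \<le> x" "x \<le> 1" "0 \<le> y" "y \<le> 1"
  shows "(x - y)\<^sup>2 / 4 \<le> (sqrt x - sqrt y)\<^sup>2"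
proof -
  have "x - y = (sqrt x - sqrt y) * (sqrt x + sqrt y)"
    using assms by (simp add: algebra_simps)
  then have "(x - y)\<^sup>2 = (sqrt x - sqrt y)\<^sup>2 * (sqrt x + sqrt y)\<^sup>2" by (simp add: power_mult_distrib)
  also have "\<dots> \<le> (sqrt x - sqrt y)\<^sup>2 * 2\<^sup>2"
  proof (intro mult_left_mono power_mono)
    have "sqrt x \<le> 1" "sqrt y \<le> 1" using assms by auto
    then show "sqrt x + sqrt y \<le> 2" by linarith
  qed (use assms in auto)
  finally show ?thesis by simp
qed

text \<open>Twice the gap between \<open>1\<close> and the coefficient is the sum of two squared
  root differences (the Hellinger distance), each at least
  \<open>(q - p)\<^sup>2 / 4\<close>.\<close>

lemma bhattacharyya_le:
  fixes p q :: real
  assumes "0 \<le> p" "p \<le> 1" "0 \<le> q" "q \<le> 1"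
  shows "sqrt (p * q) + sqrt ((1 - p) * (1 - q)) \<le> exp (- ((q - p)\<^sup>2 / 4))"
proof -
  have "(sqrt p - sqrt q)\<^sup>2 = p + q - 2 * sqrt (p * q)"
    "(sqrt (1 - p) - sqrt (1 - q))\<^sup>2 = (1 - p) + (1 - q) - 2 * sqrt ((1 - p) * (1 - q))"
    using assms by (auto simp: power2_diff real_sqrt_mult)
  with sq_diff_le_sqrt_diff[of p q] sq_diff_le_sqrt_diff[of "1 - p" "1 - q"] assms
  have "sqrt (p * q) + sqrt ((1 - p) * (1 - q)) \<le> 1 - (q - p)\<^sup>2 / 4"
    by (simp add: power2_commute)
  also have "\<dots> \<le> exp (- ((q - p)\<^sup>2 / 4))"
    using exp_ge_add_one_self[of "- ((q - p)\<^sup>2 / 4)"] by simp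
  finally show ?thesis .
qed

text \<open>
  The exponential factor is chosen so that the mean of \<open>tilt b a\<close> under \<open>bernoulli_pmf a\<close> is at
  most \<open>1\<close>. If \<open>bern_lik a g = 0\<close>, the value is \<open>0\<close>, which is harmless as \<open>g\<close> has probability \<open>0\<close>.
\<close>

definition tilt :: "real \<Rightarrow> real \<Rightarrow> bool \<Rightarrow> real" where
  "tilt b a g = sqrt (bern_lik b g / bern_lik a g) * exp ((b - a)\<^sup>2 / 4)"

lemma tilt_nonneg:
  assumes "0 \<le> a" "a \<le> 1" "0 \<le> b" "b \<le> 1"
  shows "0 \<le> tilt b a g"
  using assms by (auto simp: tilt_def intro!: mult_nonneg_nonneg divide_nonneg_nonneg bern_lik_nonneg)

text \<open>At \<open>a = 0\<close> both sides vanish, so degenerate probabilities such as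
  \<open>A i i = 1\<close> need no separate case.\<close>

lemma sqrt_divide_mult:
  assumes "0 \<le> (a::real)"
  shows "sqrt (b / a) * a = sqrt (a * b)"
proof -
  have "sqrt (b / a) * a = sqrt (b / a * a\<^sup>2)" using assms by (simp add: real_sqrt_mult del: times_divide_eq_left)
  also have "b / a * a\<^sup>2 = a * b" by (simp add: power2_eq_square)
  finally show ?thesis .
qed

lemma nn_integral_tilt_bernoulli:
  assumes "0 \<le> a" "a \<le> 1" "0 \<le> b" "b \<le> 1"
  shows "(\<integral>\<^sup>+g. ennreal (tilt b a g) \<partial>bernoulli_pmf a) \<le> 1"
proof -
  have "tilt b a True * a + tilt b a False * (1 - a)
      = (sqrt (b / a) * a + sqrt ((1 - b) / (1 - a)) * (1 - a)) * exp ((b - a)\<^sup>2 / 4)"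
    by (simp add: tilt_def bern_lik_def algebra_simps)
  also have "\<dots> = (sqrt (a * b) + sqrt ((1 - a) * (1 - b))) * exp ((b - a)\<^sup>2 / 4)"
    using assms by (simp add: sqrt_divide_mult)
  also have "\<dots> \<le> exp (- ((b - a)\<^sup>2 / 4)) * exp ((b - a)\<^sup>2 / 4)"
    using assms by (intro mult_right_mono bhattacharyya_le) auto
  also have "\<dots> = 1" by (simp flip: exp_add)
  finally have "ennreal (tilt b a True * a + tilt b a False * (1 - a)) \<le> 1"
    by (simp add: ennreal_le_1)
  then show ?thesis
    using assms by (simp add: tilt_nonneg ennreal_mult' ennreal_plus)
qed

section \<open>Chernoff bound for a fixed labelling and fixed parameters\<close>

lemma set_label_pmf:
  assumes "hub_model nL n \<rho> A" "i \<in> set_pmf (label_pmf nL \<rho>)"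
  shows "i \<le> nL"
  using assms by (auto simp: set_pmf_iff pmf_label_pmf split: if_splits)

text \<open>Given the true label, the coordinates are independent and the mean factors. The bound is
  the same for every true label, so averaging over labels preserves it.\<close>

lemma nn_integral_tilt_group:
  assumes hub: "hub_model nL n \<rho> A" and b: "\<And>j. j \<in> {1..n} \<Longrightarrow> 0 \<le> b j \<and> b j \<le> 1"
  shows "(\<integral>\<^sup>+x. (\<Prod>j=1..n. ennreal (tilt (b j) (A (fst x) j) (snd x j))) \<partial>group_pmf nL n \<rho> A) \<le> 1"
proof -
  have "(\<Prod>j=1..n. \<integral>\<^sup>+g. ennreal (tilt (b j) (A i j) g) \<partial>bernoulli_pmf (A i j)) \<le> 1"
    if "i \<in> set_pmf (label_pmf nL \<rho>)" for i
    using set_label_pmf[OF hub that] hub b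
    by (intro prod_le_1 conjI nn_integral_tilt_bernoulli) (auto simp: hub_model_def)
  then have "(\<integral>\<^sup>+i. (\<Prod>j=1..n. \<integral>\<^sup>+g. ennreal (tilt (b j) (A i j) g) \<partial>bernoulli_pmf (A i j)) \<partial>label_pmf nL \<rho>)
      \<le> (\<integral>\<^sup>+i. 1 \<partial>label_pmf nL \<rho>)"
    by (intro nn_integral_mono_AE) (simp add: AE_measure_pmf_iff)
  then show ?thesis
    by (simp add: group_pmf_def
        nn_integral_prod_Pi_pmf[where f = "\<lambda>j g. ennreal (tilt (b j) (A _ j) g)"])
qed

text \<open>Since \<open>z\<close> and \<open>B\<close> are fixed, the factor for \<open>t\<close>
  depends on group \<open>t\<close> only, and independence of the groups applies.\<close>

lemma nn_integral_tilt_sample: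
  assumes hub: "hub_model nL n \<rho> A"
    and B: "\<And>t j. t \<in> {1..T} \<Longrightarrow> j \<in> {1..n} \<Longrightarrow> 0 \<le> B (z t) j \<and> B (z t) j \<le> 1"
  shows "(\<integral>\<^sup>+\<omega>. (\<Prod>t=1..T. \<Prod>j=1..n. ennreal (tilt (B (z t) j) (A (fst (\<omega> t)) j) (observed \<omega> t j)))
      \<partial>sample_pmf nL n T \<rho> A) \<le> 1"
proof -
  have "(\<integral>\<^sup>+\<omega>. (\<Prod>t=1..T. \<Prod>j=1..n. ennreal (tilt (B (z t) j) (A (fst (\<omega> t)) j) (observed \<omega> t j)))
      \<partial>sample_pmf nL n T \<rho> A)
    = (\<Prod>t=1..T. \<integral>\<^sup>+x. (\<Prod>j=1..n. ennreal (tilt (B (z t) j) (A (fst x) j) (snd x j))) \<partial>group_pmf nL n \<rho> A)"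
    unfolding sample_pmf_def observed_def
    by (subst nn_integral_prod_Pi_pmf[symmetric]) auto
  also have "\<dots> \<le> 1"
    using B by (intro prod_le_1 conjI nn_integral_tilt_group[OF hub]) auto
  finally show ?thesis .
qed

lemma sqrt_prod: "sqrt (\<Prod>x\<in>S. f x) = (\<Prod>x\<in>S. sqrt (f x))"
  by (induction S rule: infinite_finite_induct) (auto simp: real_sqrt_mult)

lemma prod_tilt:
  "(\<Prod>t=1..T. \<Prod>j=1..n. tilt (B (z t) j) (A (y t) j) (G t j))
   = sqrt (lik n T G z B / lik n T G y A) * exp ((\<Sum>t=1..T. \<Sum>j=1..n. (B (z t) j - A (y t) j)\<^sup>2) / 4)"
  unfolding tilt_def lik_def
  by (simp add: prod.distrib prod_dividef sqrt_prod exp_sum sum_divide_distrib real_sqrt_divide)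

definition sample_labels :: "(nat \<Rightarrow> nat \<times> (nat \<Rightarrow> bool)) \<Rightarrow> nat \<Rightarrow> nat" where
  "sample_labels \<omega> t = fst (\<omega> t)"

text \<open>On the support the true likelihood is positive, so it may be divided by, and
  \<open>A i i = 1\<close> forces the hub to be present, so the true labelling is feasible.\<close>

lemma set_sample_pmf:
  assumes hub: "hub_model nL n \<rho> A" and \<omega>: "\<omega> \<in> set_pmf (sample_pmf nL n T \<rho> A)" and t: "t \<in> {1..T}"
  shows "sample_labels \<omega> t \<le> nL"
    and "j \<in> {1..n} \<Longrightarrow> 0 < bern_lik (A (sample_labels \<omega> t) j) (observed \<omega> t j)"
    and "sample_labels \<omega> t \<noteq> 0 \<Longrightarrow> observed \<omega> t (sample_labels \<omega> t)"
proof -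
  have "\<omega> t \<in> set_pmf (group_pmf nL n \<rho> A)"
    using \<omega> t by (auto simp: sample_pmf_def set_Pi_pmf PiE_dflt_def)
  then obtain i g where wt: "\<omega> t = (i, g)" and i: "i \<in> set_pmf (label_pmf nL \<rho>)"
    and g: "g \<in> set_pmf (Pi_pmf {1..n} False (\<lambda>j. bernoulli_pmf (A i j)))"
    by (auto simp: group_pmf_def)
  have inL: "i \<le> nL" using set_label_pmf[OF hub i] .
  then show "sample_labels \<omega> t \<le> nL" by (simp add: sample_labels_def wt)
  have pos: "0 < bern_lik (A i j) (g j)" if j: "j \<in> {1..n}" for j
  proof -
    have "g j \<in> set_pmf (bernoulli_pmf (A i j))"
      using g j by (auto simp: set_Pi_pmf PiE_dflt_def)
    moreover have "0 \<le> A i j" "A i j \<le> 1" using hub inL j by (auto simp: hub_model_def)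
    ultimately show ?thesis by (cases "g j") (auto simp: set_pmf_iff bern_lik_def)
  qed
  then show "j \<in> {1..n} \<Longrightarrow> 0 < bern_lik (A (sample_labels \<omega> t) j) (observed \<omega> t j)"
    by (simp add: sample_labels_def observed_def wt)
  show "sample_labels \<omega> t \<noteq> 0 \<Longrightarrow> observed \<omega> t (sample_labels \<omega> t)"
    using pos[of i] inL hub by (auto simp: sample_labels_def observed_def wt hub_model_def bern_lik_def split: if_splits)
qed

text \<open>Markov's inequality: on \<open>S\<close> the product of the tilts is at least
  \<open>exp (K / 4)\<close>, while its mean is at most \<open>1\<close>.\<close>

lemma prob_likelihood_exceeds:
  fixes K :: real
  assumes hub: "hub_model nL n \<rho> A"
    and B: "\<And>t j. t \<in> {1..T} \<Longrightarrow> j \<in> {1..n} \<Longrightarrow> 0 \<le> B (z t) j \<and> B (z t) j \<le> 1"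
  defines "S \<equiv> {\<omega>. lik n T (observed \<omega>) (sample_labels \<omega>) A \<le> lik n T (observed \<omega>) z B \<and>
      K \<le> (\<Sum>t=1..T. \<Sum>j=1..n. (B (z t) j - A (sample_labels \<omega> t) j)\<^sup>2)}"
  shows "measure_pmf.prob (sample_pmf nL n T \<rho> A) S \<le> exp (- (K / 4))"
proof -
  let ?P = "sample_pmf nL n T \<rho> A"
  have "ennreal (exp (K / 4)) * indicator S \<omega>
      \<le> (\<Prod>t=1..T. \<Prod>j=1..n. ennreal (tilt (B (z t) j) (A (fst (\<omega> t)) j) (observed \<omega> t j)))"
    if \<omega>: "\<omega> \<in> set_pmf ?P" for \<omega>
  proof (cases "\<omega> \<in> S")
    case True
    let ?q = "\<Sum>t=1..T. \<Sum>j=1..n. (B (z t) j - A (sample_labels \<omega> t) j)\<^sup>2"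
    let ?r = "lik n T (observed \<omega>) z B / lik n T (observed \<omega>) (sample_labels \<omega>) A"
    \<comment> \<open>With denominator \<open>0\<close> the quotient \<open>?r\<close> would be
      \<open>0\<close> instead of at least \<open>1\<close>.\<close>
    have "0 < lik n T (observed \<omega>) (sample_labels \<omega>) A"
      unfolding lik_def using set_sample_pmf(2)[OF hub \<omega>] by (intro prod_pos) auto
    with True have "1 * exp (K / 4) \<le> sqrt ?r * exp (?q / 4)"
      by (intro mult_mono) (auto simp: S_def)
    also have "\<dots> = (\<Prod>t=1..T. \<Prod>j=1..n. tilt (B (z t) j) (A (fst (\<omega> t)) j) (observed \<omega> t j))"
    proof -
      have "sample_labels \<omega> = (\<lambda>t. fst (\<omega> t))" by (simp add: fun_eq_iff sample_labels_def)
      then show ?thesis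
        using prod_tilt[where y = "\<lambda>t. fst (\<omega> t)" and z = z and B = B and A = A and G = "observed \<omega>"]
        by simp
    qed
    finally have "ennreal (exp (K / 4)) \<le> ennreal (\<Prod>t=1..T. \<Prod>j=1..n. tilt (B (z t) j) (A (fst (\<omega> t)) j) (observed \<omega> t j))"
      by (simp add: ennreal_leI)
    also have "\<dots> = (\<Prod>t=1..T. \<Prod>j=1..n. ennreal (tilt (B (z t) j) (A (fst (\<omega> t)) j) (observed \<omega> t j)))"
    proof -
      have nn: "0 \<le> tilt (B (z t) j) (A (fst (\<omega> t)) j) (observed \<omega> t j)" if "t \<in> {1..T}" "j \<in> {1..n}" for t j
        using set_sample_pmf(1)[OF hub \<omega> that(1)] B[OF that] hub that
        by (intro tilt_nonneg) (auto simp: hub_model_def sample_labels_def)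
      have "(\<Prod>t=1..T. \<Prod>j=1..n. ennreal (tilt (B (z t) j) (A (fst (\<omega> t)) j) (observed \<omega> t j)))
          = (\<Prod>t=1..T. ennreal (\<Prod>j=1..n. tilt (B (z t) j) (A (fst (\<omega> t)) j) (observed \<omega> t j)))"
        using nn by (intro prod.cong prod_ennreal) auto
      also have "\<dots> = ennreal (\<Prod>t=1..T. \<Prod>j=1..n. tilt (B (z t) j) (A (fst (\<omega> t)) j) (observed \<omega> t j))"
        using nn by (intro prod_ennreal prod_nonneg) auto
      finally show ?thesis by simp
    qed
    finally show ?thesis using True by simp
  qed simp
  then have "(\<integral>\<^sup>+\<omega>. ennreal (exp (K / 4)) * indicator S \<omega> \<partial>?P)
      \<le> (\<integral>\<^sup>+\<omega>. (\<Prod>t=1..T. \<Prod>j=1..n. ennreal (tilt (B (z t) j) (A (fst (\<omega> t)) j) (observed \<omega> t j))) \<partial>?P)"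
    by (intro nn_integral_mono_AE) (simp add: AE_measure_pmf_iff)
  also have "\<dots> \<le> 1" using B by (rule nn_integral_tilt_sample[OF hub])
  finally have "ennreal (exp (K / 4)) * emeasure ?P S \<le> 1"
    by (simp add: nn_integral_cmult_indicator)
  then have "ennreal (exp (K / 4) * measure_pmf.prob ?P S) \<le> 1"
    by (simp add: measure_pmf.emeasure_eq_measure ennreal_mult')
  then have "exp (K / 4) * measure_pmf.prob ?P S \<le> 1" by (simp add: ennreal_le_1)
  then show ?thesis by (simp add: exp_minus field_simps)
qed

section \<open>Union bound over labellings and parameter values\<close>

definition frac_grid :: "nat \<Rightarrow> real set" where
  "frac_grid T = (\<lambda>(a, b). real a / real b) ` {(a, b). a \<le> b \<and> b \<le> T}"

lemma frac_grid_pairs: "{(a, b). a \<le> b \<and> b \<le> T} \<subseteq> {..T} \<times> {..T :: nat}"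
  by auto

lemma finite_frac_grid: "finite (frac_grid T)"
  unfolding frac_grid_def by (rule finite_imageI, rule finite_subset[OF frac_grid_pairs]) auto

lemma card_frac_grid: "card (frac_grid T) \<le> (T + 1)\<^sup>2"
proof -
  have "card (frac_grid T) \<le> card {(a, b). a \<le> b \<and> b \<le> T}"
    unfolding frac_grid_def by (rule card_image_le, rule finite_subset[OF frac_grid_pairs]) auto
  also have "\<dots> \<le> card ({..T} \<times> {..T})" by (rule card_mono[OF _ frac_grid_pairs]) auto
  finally show ?thesis by (simp add: card_cartesian_product power2_eq_square)
qed

lemma frac_grid_bounds: "x \<in> frac_grid T \<Longrightarrow> 0 \<le> x \<and> x \<le> 1"
  by (auto simp: frac_grid_def divide_le_eq_1)

text \<open>The pair with both entries \<open>0\<close> covers an empty class, where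
  \<open>A_hat\<close> is \<open>0\<close>.\<close>

lemma A_hat_in_frac_grid: "A_hat T G z i j \<in> frac_grid T"
proof -
  have "card {t\<in>{1..T}. z t = i \<and> G t j} \<le> card {t\<in>{1..T}. z t = i}"
    by (rule card_mono) auto
  moreover have "card {t\<in>{1..T}. z t = i} \<le> T"
    by (rule order.trans[OF card_mono[of "{1..T}"]]) auto
  ultimately show ?thesis unfolding A_hat_count frac_grid_def by force
qed

text \<open>\<open>A_hat\<close> depends on the data, so the bound for fixed parameters does not
  apply to it directly. But there are only \<open>(nL + 1) ^ T\<close> labellings, and each of the
  \<open>(nL + 1) * n\<close> parameters lies in a grid of at most \<open>(T + 1)\<^sup>2\<close>
  points, so the event is a finite union.\<close>

lemma prob_any_likelihood_exceeds:
  fixes K :: real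
  assumes hub: "hub_model nL n \<rho> A"
  shows "measure_pmf.prob (sample_pmf nL n T \<rho> A)
     {\<omega>. \<exists>z. (\<forall>t\<in>{1..T}. z t \<le> nL) \<and>
        lik n T (observed \<omega>) (sample_labels \<omega>) A \<le> lik n T (observed \<omega>) z (A_hat T (observed \<omega>) z) \<and>
        K \<le> (\<Sum>t=1..T. \<Sum>j=1..n. (A_hat T (observed \<omega>) z (z t) j - A (sample_labels \<omega> t) j)\<^sup>2)}
    \<le> real ((nL + 1) ^ T * ((T + 1)\<^sup>2) ^ ((nL + 1) * n)) * exp (- (K / 4))" (is "measure_pmf.prob ?P ?E \<le> _")
proof -
  let ?S = "\<lambda>z B. {\<omega>. lik n T (observed \<omega>) (sample_labels \<omega>) A \<le> lik n T (observed \<omega>) z B \<and>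
      K \<le> (\<Sum>t=1..T. \<Sum>j=1..n. (B (z t) j - A (sample_labels \<omega> t) j)\<^sup>2)}"
  define Z :: "(nat \<Rightarrow> nat) set" where "Z = PiE {1..T} (\<lambda>_. {..nL})"
  define \<B> :: "(nat \<times> nat \<Rightarrow> real) set" where "\<B> = PiE ({..nL} \<times> {1..n}) (\<lambda>_. frac_grid T)"
  have fin: "finite (Z \<times> \<B>)"
    by (auto simp: Z_def \<B>_def intro!: finite_PiE finite_frac_grid)
  have "?E \<subseteq> (\<Union>(z, B)\<in>Z \<times> \<B>. ?S z (curry B))"
  proof safe
    fix \<omega> z
    let ?G = "observed \<omega>"
    \<comment> \<open>Restriction places the witnesses in the finite sets \<open>Z\<close> and
      \<open>\<B>\<close>; likelihood and distance only see the index ranges.\<close>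
    let ?z = "restrict z {1..T}" and ?B = "restrict (\<lambda>(i, j). A_hat T ?G z i j) ({..nL} \<times> {1..n})"
    assume z: "\<forall>t\<in>{1..T}. z t \<le> nL"
      and le: "lik n T ?G (sample_labels \<omega>) A \<le> lik n T ?G z (A_hat T ?G z)"
      and K: "K \<le> (\<Sum>t=1..T. \<Sum>j=1..n. (A_hat T ?G z (z t) j - A (sample_labels \<omega> t) j)\<^sup>2)"
    have eq: "curry ?B (?z t) j = A_hat T ?G z (z t) j" if "t \<in> {1..T}" "j \<in> {1..n}" for t j
      using that z by (simp add: curry_def)
    have "\<omega> \<in> ?S ?z (curry ?B)"
      using le K eq by (simp add: lik_def cong: prod.cong_simp sum.cong_simp)
    moreover have "?z \<in> Z" using z by (auto simp: Z_def)
    moreover have "?B \<in> \<B>" by (auto simp: \<B>_def A_hat_in_frac_grid)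
    ultimately show "\<omega> \<in> (\<Union>(z, B)\<in>Z \<times> \<B>. ?S z (curry B))" by blast
  qed
  then have "measure_pmf.prob ?P ?E \<le> measure_pmf.prob ?P (\<Union>(z, B)\<in>Z \<times> \<B>. ?S z (curry B))"
    by (intro measure_pmf.finite_measure_mono) auto
  also have "\<dots> \<le> (\<Sum>(z, B)\<in>Z \<times> \<B>. measure_pmf.prob ?P (?S z (curry B)))"
    using measure_pmf.finite_measure_subadditive_finite[OF fin, of "\<lambda>(z, B). ?S z (curry B)" ?P]
    by (simp add: case_prod_unfold)
  also have "\<dots> \<le> (\<Sum>(z, B)\<in>Z \<times> \<B>. exp (- (K / 4)))"
  proof (rule sum_mono, safe)
    fix z B assume zB: "z \<in> Z" "B \<in> \<B>"
    have "0 \<le> curry B (z t) j \<and> curry B (z t) j \<le> 1" if tj: "t \<in> {1..T}" "j \<in> {1..n}" for t j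
    proof -
      have "(z t, j) \<in> {..nL} \<times> {1..n}" using zB tj by (auto simp: Z_def)
      with zB(2) have "B (z t, j) \<in> frac_grid T" unfolding \<B>_def by (rule PiE_mem)
      then show ?thesis using frac_grid_bounds by simp
    qed
    then show "measure_pmf.prob ?P (?S z (curry B)) \<le> exp (- (K / 4))"
      by (rule prob_likelihood_exceeds[OF hub])
  qed
  also have "\<dots> = real (card Z * card \<B>) * exp (- (K / 4))"
    by (simp add: case_prod_unfold card_cartesian_product)
  also have "\<dots> \<le> real ((nL + 1) ^ T * ((T + 1)\<^sup>2) ^ ((nL + 1) * n)) * exp (- (K / 4))"
  proof (intro mult_right_mono of_nat_mono mult_mono)
    show "card Z \<le> (nL + 1) ^ T" by (simp add: Z_def card_PiE)
    have "card \<B> = card (frac_grid T) ^ ((nL + 1) * n)"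
      by (simp add: \<B>_def card_PiE card_cartesian_product)
    then show "card \<B> \<le> ((T + 1)\<^sup>2) ^ ((nL + 1) * n)"
      using card_frac_grid by (simp add: power_mono)
  qed auto
  finally show ?thesis .
qed

section \<open>Empirical frequencies\<close>

text \<open>Hoeffding's inequality for \<open>T\<close> independent indicators of \<open>S\<close>,
  each with range of width \<open>1\<close>.\<close>

lemma prob_frequency_deviates:
  fixes p :: "'a pmf" and \<eta> :: real and T :: nat
  assumes T: "0 < T" and \<eta>: "0 \<le> \<eta>"
  shows "measure_pmf.prob (Pi_pmf {1..T} dflt (\<lambda>_. p))
     {\<omega>. \<eta> * T \<le> \<bar>real (card {t\<in>{1..T}. \<omega> t \<in> S}) - measure_pmf.prob p S * T\<bar>}
    \<le> 2 * exp (- (2 * \<eta>\<^sup>2 * T))"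
proof -
  let ?P = "Pi_pmf {1..T} dflt (\<lambda>_. p)"
  have mean: "measure_pmf.expectation ?P (\<lambda>\<omega>. indicator S (\<omega> t)) = measure_pmf.prob p S"
    if "t \<in> {1..T}" for t
  proof -
    have "measure_pmf.expectation ?P (\<lambda>\<omega>. indicator S (\<omega> t) :: real)
        = measure_pmf.expectation (map_pmf (\<lambda>\<omega>. \<omega> t) ?P) (indicator S)"
      by (simp only: integral_map_pmf)
    also have "map_pmf (\<lambda>\<omega>. \<omega> t) ?P = p" using that by (subst Pi_pmf_component) auto
    finally show ?thesis by simp
  qed
  interpret Hoeffding_ineq "measure_pmf ?P" "{1..T}" "\<lambda>t \<omega>. indicator S (\<omega> t)" "\<lambda>_. 0" "\<lambda>_. 1"
    "measure_pmf.prob p S * T"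
  proof unfold_locales
    show "prob_space.indep_vars (measure_pmf ?P) (\<lambda>_. borel) (\<lambda>t \<omega>. indicator S (\<omega> t) :: real) {1..T}"
      by (intro prob_space.indep_vars_compose2[OF _ indep_vars_Pi_pmf])
        (auto simp: measure_pmf.prob_space_axioms)
    show "measure_pmf.prob p S * T
        \<equiv> \<Sum>t\<in>{1..T}. measure_pmf.expectation ?P (\<lambda>\<omega>. indicator S (\<omega> t))"
      using mean by (intro eq_reflection) (simp add: mult.commute)
  qed (auto simp: indicator_def)
  have count: "(\<Sum>t=1..T. indicator S (\<omega> t) :: real) = real (card {t\<in>{1..T}. \<omega> t \<in> S})" for \<omega>
  proof -
    have "{1..T} \<inter> {t. \<omega> t \<in> S} = {t\<in>{1..T}. \<omega> t \<in> S}" by auto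
    then show ?thesis by (simp add: indicator_def sum_of_bool_eq)
  qed
  have "- 2 * (\<eta> * T)\<^sup>2 / real T = - (2 * \<eta>\<^sup>2 * T)"
    using T by (simp add: power2_eq_square)
  then show ?thesis
    using Hoeffding_ineq_abs_ge[of "\<eta> * T"] T \<eta> unfolding count[symmetric] by simp
qed

lemma prob_label:
  assumes hub: "hub_model nL n \<rho> A" and k: "k \<le> nL"
  shows "measure_pmf.prob (group_pmf nL n \<rho> A) {x. fst x = k} = \<rho> k"
proof -
  have "map_pmf fst (group_pmf nL n \<rho> A) = label_pmf nL \<rho>"
    by (simp add: group_pmf_def map_bind_pmf bind_return_pmf')
  then have "pmf (label_pmf nL \<rho>) k = measure_pmf.prob (group_pmf nL n \<rho> A) (fst -` {k})"
    by (metis pmf_map)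
  moreover have "fst -` {k} = {x :: nat \<times> (nat \<Rightarrow> bool). fst x = k}" by auto
  ultimately show ?thesis using k by (simp add: pmf_label_pmf[OF hub])
qed

lemma prob_label_and_edge:
  assumes hub: "hub_model nL n \<rho> A" and k: "k \<le> nL" and j: "j \<in> {1..n}"
  shows "measure_pmf.prob (group_pmf nL n \<rho> A) {x. fst x = k \<and> snd x j} = \<rho> k * A k j"
proof -
  let ?S = "{x :: nat \<times> (nat \<Rightarrow> bool). fst x = k \<and> snd x j}"
  have Akj: "0 \<le> A k j" "A k j \<le> 1" "0 \<le> \<rho> k" using hub k j by (auto simp: hub_model_def)
  have inner: "emeasure (bind_pmf (Pi_pmf {1..n} False (\<lambda>j. bernoulli_pmf (A i j))) (\<lambda>g. return_pmf (i, g))) ?S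
      = ennreal (A k j) * indicator {k} i" for i
  proof -
    let ?Q = "Pi_pmf {1..n} False (\<lambda>j. bernoulli_pmf (A i j))"
    have "emeasure (bind_pmf ?Q (\<lambda>g. return_pmf (i, g))) ?S = emeasure ?Q ((\<lambda>g. (i, g)) -` ?S)"
      by (simp add: map_pmf_def[symmetric])
    also have "\<dots> = ennreal (A k j) * indicator {k} i"
    proof (cases "i = k")
      case True
      have "emeasure ?Q {g. g j} = emeasure (map_pmf (\<lambda>g. g j) ?Q) {True}"
        by (simp add: vimage_def)
      also have "map_pmf (\<lambda>g. g j) ?Q = bernoulli_pmf (A i j)" using j by (subst Pi_pmf_component) auto
      finally show ?thesis using True Akj by (simp add: vimage_def emeasure_pmf_single)
    qed (simp add: vimage_def)
    finally show ?thesis .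
  qed
  have "emeasure (group_pmf nL n \<rho> A) ?S = (\<integral>\<^sup>+i. ennreal (A k j) * indicator {k} i \<partial>label_pmf nL \<rho>)"
    unfolding group_pmf_def by (subst emeasure_bind_pmf) (simp only: inner)
  also have "\<dots> = ennreal (A k j) * ennreal (\<rho> k)"
    using k by (simp add: nn_integral_cmult_indicator emeasure_pmf_single pmf_label_pmf[OF hub])
  finally show ?thesis
    using Akj by (simp add: measure_pmf.emeasure_eq_measure mult.commute flip: ennreal_mult)
qed

section \<open>Error probability for a single model\<close>

lemma prob_A_hat_error:
  fixes D \<tau> \<eta> c ca \<epsilon> :: real
  assumes hub: "hub_model nL n \<rho> A" and T: "0 < T"
    and est: "profile_likelihood_estimator nL n T zhat"
    and sep: "\<And>k k'. k \<le> nL \<Longrightarrow> k' \<le> nL \<Longrightarrow> k \<noteq> k' \<Longrightarrow> D \<le> (\<Sum>j=1..n. (A k j - A k' j)\<^sup>2)"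
    and D: "0 < D" and c: "0 < c" and rho: "\<And>k. k \<le> nL \<Longrightarrow> c + \<eta> \<le> \<rho> k"
    and \<eta>: "0 < \<eta>"
    and ca: "\<And>i k. i \<in> {1..nL} \<Longrightarrow> k \<le> nL \<Longrightarrow> i \<noteq> k \<Longrightarrow> A k i \<le> ca" "ca < 1"
    and tau: "(real nL + 1) * \<tau> < c" "2 * \<eta> + real nL * \<tau> < (1 - ca) * c"
    and \<epsilon>: "(4 * real nL * \<tau> + 2 * \<eta>) / c \<le> \<epsilon>"
  shows "measure_pmf.prob (sample_pmf nL n T \<rho> A)
      {\<omega>. \<epsilon> < \<bar>A_hat_error nL n T A (observed \<omega>) (zhat (observed \<omega>))\<bar>}
    \<le> real ((nL + 1) ^ T * ((T + 1)\<^sup>2) ^ ((nL + 1) * n)) * exp (- (D * (\<tau> * T) / 8))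
      + (real nL + 1) * (real n + 1) * (2 * exp (- (2 * \<eta>\<^sup>2 * T)))"
proof -
  let ?P = "sample_pmf nL n T \<rho> A"
  \<comment> \<open>The threshold in the hypothesis \<open>close\<close> of
    \<open>A_hat_deviation\<close>.\<close>
  let ?K = "D * (\<tau> * T) / 2"
  \<comment> \<open>Nodes start at \<open>1\<close>, so the index \<open>0\<close> is free to encode
    the event for the label alone; one family then controls both kinds of counts.\<close>
  define S where "S k j = (if j = 0 then {x :: nat \<times> (nat \<Rightarrow> bool). fst x = k} else {x. fst x = k \<and> snd x j})" for k j :: nat
  \<comment> \<open>Quantifying over all labellings covers the data-dependent choice
    \<open>zhat\<close>.\<close>
  define E where "E = {\<omega>. \<exists>z. (\<forall>t\<in>{1..T}. z t \<le> nL) \<and>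
        lik n T (observed \<omega>) (sample_labels \<omega>) A \<le> lik n T (observed \<omega>) z (A_hat T (observed \<omega>) z) \<and>
        ?K \<le> (\<Sum>t=1..T. \<Sum>j=1..n. (A_hat T (observed \<omega>) z (z t) j - A (sample_labels \<omega> t) j)\<^sup>2)}"
  define F where "F k j = {\<omega>. \<eta> * T \<le> \<bar>real (card {t\<in>{1..T}. \<omega> t \<in> S k j}) -
        measure_pmf.prob (group_pmf nL n \<rho> A) (S k j) * T\<bar>}" for k j
  have S0: "measure_pmf.prob (group_pmf nL n \<rho> A) (S k 0) = \<rho> k" if "k \<le> nL" for k
    using prob_label[OF hub that] by (simp add: S_def)
  have S1: "measure_pmf.prob (group_pmf nL n \<rho> A) (S k j) = \<rho> k * A k j" if "k \<le> nL" "j \<in> {1..n}" for k j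
    using prob_label_and_edge[OF hub that] that by (simp add: S_def)
  \<comment> \<open>Outside the exceptional events the deterministic lemma
    \<open>A_hat_deviation\<close> applies, with sampling error \<open>2 * \<eta>\<close>.\<close>
  have good: "\<bar>A_hat_error nL n T A (observed \<omega>) (zhat (observed \<omega>))\<bar> \<le> \<epsilon>"
    if \<omega>: "\<omega> \<in> set_pmf ?P" and notE: "\<omega> \<notin> E" and notF: "\<And>k j. k \<le> nL \<Longrightarrow> j \<le> n \<Longrightarrow> \<omega> \<notin> F k j" for \<omega>
  proof -
    let ?G = "observed \<omega>" and ?y = "sample_labels \<omega>"
    let ?z = "zhat ?G"
    have feas: "feasible nL T ?G ?z"
      and max: "\<And>z. feasible nL T ?G z \<Longrightarrow> profile_loglik n T ?G z \<le> profile_loglik n T ?G ?z"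
      using est by (auto simp: profile_likelihood_estimator_def is_arg_max_linorder)
    have y: "\<And>t. t \<in> {1..T} \<Longrightarrow> ?y t \<le> nL" using set_sample_pmf(1)[OF hub \<omega>] .
    have "feasible nL T ?G ?y"
      using y set_sample_pmf(3)[OF hub \<omega>] unfolding feasible_def by fastforce
    then have "profile_loglik n T ?G ?y \<le> profile_loglik n T ?G ?z" by (rule max)
    then have "lik n T ?G ?y (A_hat T ?G ?y) \<le> lik n T ?G ?z (A_hat T ?G ?z)"
      by (simp flip: exp_profile_loglik)
    moreover have "lik n T ?G ?y A \<le> lik n T ?G ?y (A_hat T ?G ?y)"
      using y hub by (intro lik_le_profile) (auto simp: hub_model_def)
    moreover have "\<forall>t\<in>{1..T}. ?z t \<le> nL" using feas by (auto simp: feasible_def)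
    ultimately have close: "(\<Sum>t=1..T. \<Sum>j=1..n. (A_hat T ?G ?z (?z t) j - A (?y t) j)\<^sup>2) < ?K"
      using notE unfolding E_def by force
    have lab: "{t\<in>{1..T}. \<omega> t \<in> S k 0} = {t\<in>{1..T}. ?y t = k}" for k
      by (auto simp: S_def sample_labels_def)
    have edge: "{t\<in>{1..T}. \<omega> t \<in> S k j} = {t\<in>{1..T}. ?y t = k \<and> ?G t j}" if "j \<in> {1..n}" for k j
      using that by (auto simp: S_def sample_labels_def observed_def)
    have count: "\<bar>real (label_count T ?y k) - \<rho> k * T\<bar> < \<eta> * T" if "k \<le> nL" for k
      using notF[OF that, of 0] S0[OF that] lab[of k] by (simp add: F_def label_count_def not_le)
    \<comment> \<open>One \<eta> comes from the joint count, the other from replacing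
      \<open>\<rho> k * T\<close> by the label count.\<close>
    have freq: "\<bar>real (card {t\<in>{1..T}. ?y t = k \<and> ?G t j}) - A k j * real (label_count T ?y k)\<bar> \<le> 2 * \<eta> * T"
      if kj: "k \<le> nL" "j \<in> {1..n}" for k j
    proof -
      have "\<bar>real (card {t\<in>{1..T}. ?y t = k \<and> ?G t j}) - \<rho> k * A k j * T\<bar> < \<eta> * T"
        using notF[of k j] kj S1[OF kj] edge[OF kj(2)] by (simp add: F_def not_le)
      moreover have "\<bar>A k j * (real (label_count T ?y k) - \<rho> k * T)\<bar> \<le> 1 * (\<eta> * T)"
        unfolding abs_mult using count[OF kj(1)] hub kj by (intro mult_mono) (auto simp: hub_model_def)
      ultimately show ?thesis by (simp add: algebra_simps)
    qed
    have "\<bar>A_hat T ?G ?z i j - A i j\<bar> \<le> \<epsilon>" if ij: "i \<le> nL" "j \<in> {1..n}" for i j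
    proof -
      have "\<bar>A_hat T ?G ?z i j - A i j\<bar> \<le> (4 * real nL * \<tau> + 2 * \<eta>) / c"
      proof (rule A_hat_deviation[OF T y feas sep D _ close c _ freq ca tau ij])
        show "nL \<le> n" using hub by (simp add: hub_model_def)
        fix k assume k: "k \<le> nL"
        have "(c + \<eta>) * T \<le> \<rho> k * T" using rho[OF k] by (intro mult_right_mono) auto
        then show "c * T \<le> real (label_count T ?y k)"
          using count[OF k] by (simp add: algebra_simps)
      qed
      with \<epsilon> show ?thesis by linarith
    qed
    moreover have "{0..nL} \<times> {1..n} \<noteq> {}" using hub by (auto simp: hub_model_def)
    ultimately have "A_hat_error nL n T A ?G ?z \<le> \<epsilon>"
      and "0 \<le> A_hat_error nL n T A ?G ?z"
      unfolding A_hat_error_def by (auto simp: Max_ge_iff)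
    then show ?thesis by simp
  qed
  have "measure_pmf.prob ?P {\<omega>. \<epsilon> < \<bar>A_hat_error nL n T A (observed \<omega>) (zhat (observed \<omega>))\<bar>}
      \<le> measure_pmf.prob ?P (E \<union> (\<Union>(k, j)\<in>{..nL} \<times> {..n}. F k j))"
    using good by (intro measure_pmf.finite_measure_mono_AE) (fastforce simp: AE_measure_pmf_iff)+
  also have "\<dots> \<le> measure_pmf.prob ?P E + measure_pmf.prob ?P (\<Union>(k, j)\<in>{..nL} \<times> {..n}. F k j)"
    by (intro measure_Un_le) auto
  also have "measure_pmf.prob ?P (\<Union>(k, j)\<in>{..nL} \<times> {..n}. F k j)
      \<le> (\<Sum>(k, j)\<in>{..nL} \<times> {..n}. measure_pmf.prob ?P (F k j))"
    using measure_pmf.finite_measure_subadditive_finite[of "{..nL} \<times> {..n}" "\<lambda>(k, j). F k j" ?P]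
    by (simp add: case_prod_unfold)
  also have "\<dots> \<le> (\<Sum>(k, j)\<in>{..nL} \<times> {..n}. 2 * exp (- (2 * \<eta>\<^sup>2 * T)))"
    unfolding F_def sample_pmf_def case_prod_unfold
    using T \<eta> by (intro sum_mono prob_frequency_deviates) auto
  also have "measure_pmf.prob ?P E
      \<le> real ((nL + 1) ^ T * ((T + 1)\<^sup>2) ^ ((nL + 1) * n)) * exp (- (?K / 4))"
    unfolding E_def by (rule prob_any_likelihood_exceeds[OF hub])
  finally show ?thesis by (simp add: case_prod_unfold card_cartesian_product algebra_simps)
qed

section \<open>Asymptotics\<close>

text \<open>The logarithm of the cardinality, divided by \<open>g m * n m * T m\<close>, is a
  multiple of \<open>1 / (g m * n m)\<close> plus a multiple of
  \<open>ln (T m) / (g m * T m)\<close>, up to replacing \<open>T m + 1\<close> by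
  \<open>T m\<close>. Both vanish, so half of the negative exponent survives.\<close>

lemma likelihood_term_tendsto_0:
  fixes n T :: "nat \<Rightarrow> nat" and g :: "nat \<Rightarrow> real" and \<kappa> :: real
  assumes g: "\<And>m. 0 < g m" and \<kappa>: "0 < \<kappa>"
    and T_lim: "filterlim T at_top sequentially"
    and gn: "filterlim (\<lambda>m. g m * real (n m)) at_top sequentially"
    and gT: "(\<lambda>m. ln (real (T m)) / (g m * real (T m))) \<longlonglongrightarrow> 0"
  shows "(\<lambda>m. real ((nL + 1) ^ T m * ((T m + 1)\<^sup>2) ^ ((nL + 1) * n m)) *
      exp (- (\<kappa> * (g m * real (n m)) * real (T m)))) \<longlonglongrightarrow> 0"
proof (rule tendsto_sandwich[where f = "\<lambda>_. 0"])
  \<comment> \<open>In \<open>4\<close>, one factor \<open>2\<close> is the exponent of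
    \<open>T + 1\<close>, the other comes from \<open>ln (T + 1) \<le> 2 * ln T\<close> for
    \<open>T \<ge> 2\<close>.\<close>
  let ?a = "ln (real nL + 1)" and ?b = "4 * (real nL + 1)"
  let ?w = "\<lambda>m. g m * real (n m)"
  have lim: "(\<lambda>m. ?a / ?w m + ?b * (ln (real (T m)) / (g m * real (T m)))) \<longlonglongrightarrow> 0 + ?b * 0"
    by (intro tendsto_add tendsto_mult tendsto_const gT real_tendsto_divide_at_top[OF tendsto_const gn])
  then have ev: "\<forall>\<^sub>F m in sequentially. ?a / ?w m + ?b * (ln (real (T m)) / (g m * real (T m))) < \<kappa> / 2"
    using \<kappa> by (intro order_tendstoD(2)[OF lim]) auto
  have T2: "\<forall>\<^sub>F m in sequentially. 2 \<le> T m" using T_lim by (simp add: filterlim_at_top)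
  have w0: "\<forall>\<^sub>F m in sequentially. 0 < ?w m" using gn by (simp add: filterlim_at_top_dense)
  show "\<forall>\<^sub>F m in sequentially. real ((nL + 1) ^ T m * ((T m + 1)\<^sup>2) ^ ((nL + 1) * n m)) *
      exp (- (\<kappa> * ?w m * real (T m))) \<le> exp (- (\<kappa> / 2 * ?w m))"
    using ev T2 w0
  proof eventually_elim
    case (elim m)
    let ?T = "real (T m)" and ?n = "real (n m)"
    have Tp: "2 \<le> ?T" using elim(2) by simp
    have n0: "0 < ?n" using elim(3) g[of m] by (simp add: zero_less_mult_iff)
    have "ln (?T + 1) \<le> ln (?T\<^sup>2)"
    proof -
      have "?T + 1 \<le> ?T * 2" using Tp by simp
      also have "\<dots> \<le> ?T * ?T" using Tp by (intro mult_left_mono) auto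
      finally show ?thesis using Tp by (simp add: power2_eq_square)
    qed
    also have "\<dots> = 2 * ln ?T" using Tp by (simp add: ln_realpow)
    finally have lnT: "ln (?T + 1) \<le> 2 * ln ?T" .
    have "real ((nL + 1) ^ T m * ((T m + 1)\<^sup>2) ^ ((nL + 1) * n m))
        = exp (?T * ?a) * exp (2 * ((real nL + 1) * ?n) * ln (?T + 1))"
    proof -
      have "exp (2 * ((real nL + 1) * ?n) * ln (?T + 1)) = exp (real (2 * ((nL + 1) * n m)) * ln (?T + 1))"
        by (simp only: of_nat_mult of_nat_add of_nat_1 of_nat_numeral)
      also have "\<dots> = (?T + 1) ^ (2 * ((nL + 1) * n m))"
        unfolding exp_of_nat_mult using Tp by simp
      also have "\<dots> = ((?T + 1)\<^sup>2) ^ ((nL + 1) * n m)" by (rule power_mult)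
      finally have "exp (2 * ((real nL + 1) * ?n) * ln (?T + 1)) = ((?T + 1)\<^sup>2) ^ ((nL + 1) * n m)" .
      moreover have "exp (?T * ?a) = (real nL + 1) ^ T m" unfolding exp_of_nat_mult by simp
      ultimately show ?thesis
        by (simp only: of_nat_mult of_nat_power of_nat_add of_nat_1)
    qed
    also have "\<dots> * exp (- (\<kappa> * ?w m * ?T))
        = exp (?T * ?a + 2 * ((real nL + 1) * ?n) * ln (?T + 1) - \<kappa> * ?w m * ?T)"
      by (simp only: exp_add[symmetric] diff_conv_add_uminus)
    also have "\<dots> \<le> exp (- (\<kappa> / 2 * ?w m))"
    proof -
      have "?T * ?a + 2 * ((real nL + 1) * ?n) * ln (?T + 1) \<le> ?T * ?a + ?b * ?n * ln ?T"
        using mult_left_mono[OF lnT, of "2 * ((real nL + 1) * ?n)"] by (simp add: algebra_simps)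
      also have "\<dots> = (?w m * ?T) * (?a / ?w m + ?b * (ln ?T / (g m * ?T)))"
        using n0 g[of m] Tp by (simp add: field_simps)
      also have "\<dots> \<le> (?w m * ?T) * (\<kappa> / 2)"
        by (intro mult_left_mono less_imp_le[OF elim(1)] mult_nonneg_nonneg less_imp_le[OF elim(3)]) simp
      finally have "?T * ?a + 2 * ((real nL + 1) * ?n) * ln (?T + 1) - \<kappa> * ?w m * ?T \<le> - (\<kappa> / 2 * ?w m * ?T)"
        by (simp add: algebra_simps)
      also have "\<dots> \<le> - (\<kappa> / 2 * ?w m * 1)"
        using \<kappa> elim(3) Tp by (intro le_imp_neg_le mult_left_mono) auto
      finally show ?thesis by simp
    qed
    finally show ?case .
  qed
  have "filterlim (\<lambda>m. \<kappa> / 2 * ?w m) at_top sequentially"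
    using \<kappa> by (intro filterlim_tendsto_pos_mult_at_top[OF tendsto_const _ gn]) auto
  then show "(\<lambda>m. exp (- (\<kappa> / 2 * ?w m))) \<longlonglongrightarrow> 0"
    by (intro filterlim_compose[OF exp_at_bot]) (simp add: filterlim_uminus_at_bot)
qed auto

text \<open>Once \<open>ln (n m) < \<eta>\<^sup>2 * T m\<close>, the factor \<open>n m\<close> costs
  at most half of the exponent.\<close>

lemma frequency_term_tendsto_0:
  fixes n T :: "nat \<Rightarrow> nat" and \<eta> C :: real
  assumes \<eta>: "0 < \<eta>" and C: "0 \<le> C" and n1: "\<And>m. 1 \<le> n m"
    and T_lim: "filterlim T at_top sequentially"
    and nT: "(\<lambda>m. ln (real (n m)) / real (T m)) \<longlonglongrightarrow> 0"
  shows "(\<lambda>m. C * (real (n m) + 1) * (2 * exp (- (2 * \<eta>\<^sup>2 * real (T m))))) \<longlonglongrightarrow> 0"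
proof (rule tendsto_sandwich[where f = "\<lambda>_. 0"])
  have ev: "\<forall>\<^sub>F m in sequentially. ln (real (n m)) / real (T m) < \<eta>\<^sup>2"
    using \<eta> by (intro order_tendstoD(2)[OF nT]) auto
  have T1: "\<forall>\<^sub>F m in sequentially. 1 \<le> T m" using T_lim by (simp add: filterlim_at_top)
  show "\<forall>\<^sub>F m in sequentially. C * (real (n m) + 1) * (2 * exp (- (2 * \<eta>\<^sup>2 * real (T m))))
      \<le> 4 * C * exp (- (\<eta>\<^sup>2 * real (T m)))"
    using ev T1
  proof eventually_elim
    case (elim m)
    let ?n = "real (n m)" and ?T = "real (T m)"
    have n: "1 \<le> ?n" using n1[of m] by simp
    have "?n * exp (- (2 * \<eta>\<^sup>2 * ?T)) = exp (ln ?n - 2 * \<eta>\<^sup>2 * ?T)"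
      using n by (simp add: exp_diff exp_minus field_simps)
    also have "\<dots> \<le> exp (- (\<eta>\<^sup>2 * ?T))"
      using elim by (simp add: field_simps)
    finally have le: "?n * exp (- (2 * \<eta>\<^sup>2 * ?T)) \<le> exp (- (\<eta>\<^sup>2 * ?T))" .
    have "C * (?n + 1) * (2 * exp (- (2 * \<eta>\<^sup>2 * ?T))) \<le> C * (2 * ?n) * (2 * exp (- (2 * \<eta>\<^sup>2 * ?T)))"
      using n C by (intro mult_mono) auto
    also have "\<dots> = 4 * C * (?n * exp (- (2 * \<eta>\<^sup>2 * ?T)))" by simp
    also have "\<dots> \<le> 4 * C * exp (- (\<eta>\<^sup>2 * ?T))"
      using le C by (intro mult_left_mono) auto
    finally show ?case .
  qed
  have "filterlim (\<lambda>m. real (T m)) at_top sequentially"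
    by (rule filterlim_compose[OF filterlim_real_sequentially T_lim])
  then have "filterlim (\<lambda>m. \<eta>\<^sup>2 * real (T m)) at_top sequentially"
    using \<eta> by (intro filterlim_tendsto_pos_mult_at_top[OF tendsto_const]) auto
  then have "(\<lambda>m. exp (- (\<eta>\<^sup>2 * real (T m)))) \<longlonglongrightarrow> 0"
    by (intro filterlim_compose[OF exp_at_bot]) (simp add: filterlim_uminus_at_bot)
  then show "(\<lambda>m. 4 * C * exp (- (\<eta>\<^sup>2 * real (T m)))) \<longlonglongrightarrow> 0"
    by (rule tendsto_mult_right_zero)
qed (use C in auto)

text \<open>Of two distinct rows at least one belongs to a hub, and its set \<open>V\<close> already
  gives the bound; symmetry of the square settles \<open>k = 0\<close>.\<close>

lemma row_separation:
  fixes A :: "nat \<Rightarrow> nat \<Rightarrow> real"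
  assumes sep: "\<And>i. i \<in> {1..nL} \<Longrightarrow> \<exists>V\<subseteq>{1..n}. a \<le> real (card V) \<and>
      (\<forall>j\<in>V. \<forall>i'\<in>{0..nL}. i' \<noteq> i \<longrightarrow> d \<le> A i j - A i' j)"
    and d: "0 \<le> d" and k: "k \<le> nL" "k' \<le> nL" "k \<noteq> k'"
  shows "d\<^sup>2 * a \<le> (\<Sum>j=1..n. (A k j - A k' j)\<^sup>2)"
proof -
  have one: "d\<^sup>2 * a \<le> (\<Sum>j=1..n. (A i j - A i' j)\<^sup>2)"
    if i: "1 \<le> i" "i \<le> nL" "i' \<le> nL" "i' \<noteq> i" for i i'
  proof -
    obtain V where V: "V \<subseteq> {1..n}" "a \<le> real (card V)" "\<And>j. j \<in> V \<Longrightarrow> d \<le> A i j - A i' j"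
      using sep[of i] i by auto
    have "d\<^sup>2 * a \<le> (\<Sum>j\<in>V. d\<^sup>2)"
      using V(2) by (simp add: mult.commute mult_right_mono)
    also have "\<dots> \<le> (\<Sum>j\<in>V. (A i j - A i' j)\<^sup>2)"
      using V(3) d by (intro sum_mono power_mono)
    also have "\<dots> \<le> (\<Sum>j=1..n. (A i j - A i' j)\<^sup>2)"
      using V(1) by (intro sum_mono2) auto
    finally show ?thesis .
  qed
  show ?thesis
  proof (cases "k = 0")
    case True
    then show ?thesis using one[of k' k] k by (simp add: power2_commute)
  qed (use one[of k k'] k in auto)
qed

theorem theorem10:
  fixes nL :: nat
    and n T :: "nat \<Rightarrow> nat"
    and \<rho> :: "nat \<Rightarrow> nat \<Rightarrow> real"
    and A :: "nat \<Rightarrow> nat \<Rightarrow> nat \<Rightarrow> real"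
    and d v :: "nat \<Rightarrow> real"
    and c_min c_max :: real
    and zhat :: "nat \<Rightarrow> (nat \<Rightarrow> nat \<Rightarrow> bool) \<Rightarrow> (nat \<Rightarrow> nat)"
  assumes model: "\<And>m. hub_model nL (n m) (\<rho> m) (A m)"
    and n_lim: "filterlim n at_top sequentially"
    and T_lim: "filterlim T at_top sequentially"
    and c_pos: "0 < c_min" "0 < c_max"
    and rho_min: "\<And>m. Min (\<rho> m ` {0..nL}) = c_min / real nL"
    and rho_max: "\<And>m. Max (\<rho> m ` {0..nL}) = c_max / real nL"
    and d_range: "\<And>m. 0 < d m \<and> d m \<le> 1"
    and v_range: "\<And>m. 0 < v m \<and> v m \<le> 1"
    and separation:
      "\<And>m i. i \<in> {1..nL} \<Longrightarrow>
         \<exists>V\<subseteq>{1..n m}. real (card V) \<ge> v m * real (n m) / real nL \<and>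
           (\<forall>j\<in>V. \<forall>i'\<in>{0..nL}. i' \<noteq> i \<longrightarrow> A m i j - A m i' j \<ge> d m)"
    and bounded_away:
      "\<exists>c<1. \<forall>m. \<forall>i\<in>{0..nL}. \<forall>i'\<in>{1..nL}. i \<noteq> i' \<longrightarrow> A m i i' \<le> c"
    and rate_T: "(\<lambda>m. ln (real (T m)) / ((d m)\<^sup>2 * v m * real (T m))) \<longlonglongrightarrow> 0"
    and rate_n: "filterlim (\<lambda>m. (d m) ^ 4 * (v m)\<^sup>2 * real (n m)) at_top sequentially"
    and rate_nT: "(\<lambda>m. ln (real (n m)) / real (T m)) \<longlonglongrightarrow> 0"
    and estimator: "\<And>m. profile_likelihood_estimator nL (n m) (T m) (zhat m)"
  shows "is_op1 (\<lambda>m. sample_pmf nL (n m) (T m) (\<rho> m) (A m))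
           (\<lambda>m \<omega>. A_hat_error nL (n m) (T m) (A m) (observed \<omega>) (zhat m (observed \<omega>)))"
  unfolding is_op1_def
proof (intro allI impI)
  fix \<epsilon> :: real assume \<epsilon>: "0 < \<epsilon>"
  have nL: "1 \<le> nL" and n1: "1 \<le> n m" for m
    using model[of m] by (auto simp: hub_model_def)
  obtain ca where ca: "ca < 1"
    and ca_le: "\<And>m i i'. i \<le> nL \<Longrightarrow> i' \<in> {1..nL} \<Longrightarrow> i \<noteq> i' \<Longrightarrow> A m i i' \<le> ca"
    using bounded_away by auto
  \<comment> \<open>Half of the smallest group proportion; the other half absorbs the sampling error
    \<open>x \<le> c\<close>.\<close>
  define c where "c = c_min / real nL / 2"
  define \<mu> where "\<mu> = min c (min ((1 - ca) * c) (c * \<epsilon>))"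
  \<comment> \<open>\<open>x\<close> will serve as both \<tau> and \<eta>. The multiples
    \<open>nL + 1\<close>, \<open>nL + 2\<close> and \<open>4 * nL + 2\<close> of \<open>x\<close>
    required by \<open>prob_A_hat_error\<close> all stay below \<open>6 * (nL + 1) * x\<close>,
    which is \<open>\<mu>\<close>.\<close>
  define x where "x = \<mu> / (6 * (real nL + 1))"
  have c: "0 < c" using c_pos nL by (simp add: c_def)
  then have \<mu>: "0 < \<mu>" "\<mu> \<le> c" "\<mu> \<le> (1 - ca) * c" "\<mu> \<le> c * \<epsilon>"
    using \<epsilon> ca by (auto simp: \<mu>_def)
  have x: "0 < x" using \<mu> by (simp add: x_def)
  have x6: "6 * (real nL * x) + 6 * x = \<mu>"
  proof -
    have "6 * (real nL + 1) * x = \<mu>" by (simp add: x_def)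
    then show ?thesis by (simp add: algebra_simps)
  qed
  have nLx: "0 < real nL * x" using nL x by simp
  have rho: "c + x \<le> \<rho> m k" if "k \<le> nL" for m k
  proof -
    have "c_min / real nL \<le> \<rho> m k" unfolding rho_min[of m, symmetric] using that by (intro Min_le) auto
    then show ?thesis using x6 \<mu> nLx x by (simp add: c_def)
  qed
  define g where "g m = (d m)\<^sup>2 * v m" for m
  have g: "0 < g m" for m using d_range[of m] v_range[of m] by (simp add: g_def)
  \<comment> \<open>The rate hypothesis concerns \<open>g m * g m * n m\<close>, which is smaller
    because \<open>g m \<le> 1\<close>.\<close>
  have gn: "filterlim (\<lambda>m. g m * real (n m)) at_top sequentially"
  proof (rule filterlim_at_top_mono[OF rate_n], intro always_eventually allI)
    fix m
    have "g m \<le> 1 * 1" unfolding g_def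
      using d_range[of m] v_range[of m] by (intro mult_mono power_le_one) auto
    then have "g m * g m \<le> 1 * g m" using g[of m] by (intro mult_right_mono) auto
    then have "g m * g m * real (n m) \<le> g m * real (n m)" by (intro mult_right_mono) auto
    then show "(d m) ^ 4 * (v m)\<^sup>2 * real (n m) \<le> g m * real (n m)"
      by (simp add: g_def power2_eq_square power4_eq_xxxx mult_ac)
  qed
  \<comment> \<open>Chosen to match the exponent \<open>D m * (x * T m) / 8\<close>, where
    \<open>D m\<close> is \<open>g m * n m / nL\<close>.\<close>
  define \<kappa> where "\<kappa> = x / (8 * real nL)"
  define D where "D m = (d m)\<^sup>2 * (v m * real (n m) / real nL)" for m
  let ?bound = "\<lambda>m. real ((nL + 1) ^ T m * ((T m + 1)\<^sup>2) ^ ((nL + 1) * n m)) *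
        exp (- (\<kappa> * (g m * real (n m)) * real (T m)))
      + (real nL + 1) * (real (n m) + 1) * (2 * exp (- (2 * x\<^sup>2 * real (T m))))"
  show "(\<lambda>m. measure_pmf.prob (sample_pmf nL (n m) (T m) (\<rho> m) (A m))
      {\<omega>. \<epsilon> < \<bar>A_hat_error nL (n m) (T m) (A m) (observed \<omega>) (zhat m (observed \<omega>))\<bar>}) \<longlonglongrightarrow> 0"
  proof (rule tendsto_sandwich[where f = "\<lambda>_. 0"])
    have "?bound \<longlonglongrightarrow> 0 + 0"
    proof (rule tendsto_add)
      show "(\<lambda>m. real ((nL + 1) ^ T m * ((T m + 1)\<^sup>2) ^ ((nL + 1) * n m)) *
          exp (- (\<kappa> * (g m * real (n m)) * real (T m)))) \<longlonglongrightarrow> 0"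
        using g x nL T_lim gn rate_T unfolding \<kappa>_def
        by (intro likelihood_term_tendsto_0) (auto simp: g_def)
      show "(\<lambda>m. (real nL + 1) * (real (n m) + 1) * (2 * exp (- (2 * x\<^sup>2 * real (T m))))) \<longlonglongrightarrow> 0"
        using x n1 T_lim rate_nT by (intro frequency_term_tendsto_0) auto
    qed
    then show "?bound \<longlonglongrightarrow> 0" by simp
    have "\<forall>\<^sub>F m in sequentially. 1 \<le> T m" using T_lim by (simp add: filterlim_at_top)
    then show "\<forall>\<^sub>F m in sequentially. measure_pmf.prob (sample_pmf nL (n m) (T m) (\<rho> m) (A m))
        {\<omega>. \<epsilon> < \<bar>A_hat_error nL (n m) (T m) (A m) (observed \<omega>) (zhat m (observed \<omega>))\<bar>} \<le> ?bound m"
    proof eventually_elim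
      case (elim m)
      have "(4 * real nL * x + 2 * x) / c \<le> \<epsilon>"
        using x6 \<mu> c nLx x by (simp add: pos_divide_le_eq mult.commute)
      moreover have "2 * x + real nL * x < (1 - ca) * c" "(real nL + 1) * x < c"
        using x6 \<mu> nLx x by (auto simp: algebra_simps)
      moreover have "0 < D m" using d_range[of m] v_range[of m] n1[of m] nL by (simp add: D_def)
      moreover have "D m \<le> (\<Sum>j=1..n m. (A m k j - A m k' j)\<^sup>2)"
        if "k \<le> nL" "k' \<le> nL" "k \<noteq> k'" for k k'
        unfolding D_def using separation d_range[of m] that by (intro row_separation) auto
      ultimately have "measure_pmf.prob (sample_pmf nL (n m) (T m) (\<rho> m) (A m))
          {\<omega>. \<epsilon> < \<bar>A_hat_error nL (n m) (T m) (A m) (observed \<omega>) (zhat m (observed \<omega>))\<bar>}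
        \<le> real ((nL + 1) ^ T m * ((T m + 1)\<^sup>2) ^ ((nL + 1) * n m)) * exp (- (D m * (x * real (T m)) / 8))
          + (real nL + 1) * (real (n m) + 1) * (2 * exp (- (2 * x\<^sup>2 * real (T m))))"
        using elim c x ca
        by (intro prob_A_hat_error[OF model _ estimator, where c = c and ca = ca] rho ca_le) auto
      also have "D m * (x * real (T m)) / 8 = \<kappa> * (g m * real (n m)) * real (T m)"
        by (simp add: D_def \<kappa>_def g_def mult_ac)
      finally show ?case .
    qed
  qed auto
qed

end
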